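(* Let $n,r,k,t$ be integers with $n\geq 4r+10$, $r+1\geq 3k+2t$, $k+t\geq 2$, $k\geq 1$, $t\geq 0$. Then $\sigma(K_{r+1}-(kP_2\cup tK_2), n)=(r-1)(2n-r)-2(n-r)$.
   Context: A non-increasing sequence $\pi=(d_1,\dots,d_n)$ of nonnegative integers is graphic if it is the degree sequence of a simple graph on $n$ vertices (a realization of $\pi$); $\sigma(\pi)=d_1+\cdots+d_n$. For a graph $F$, $\pi$ is potentially $F$-graphic if some realization of $\pi$ contains $F$ as a subgraph. $\sigma(F,n)$ denotes the smallest even integer $l$ such that every $n$-term graphic sequence $\pi$ with $\sigma(\pi)\geq l$ is potentially $F$-graphic. $K_m$ is the complete graph on $m$ vertices; $P_2$ denotes the path with 2 edges (on 3 vertices); $K_2$ is a single edge; $kP_2\cup tK_2$ is the disjoint union of $k$ copies of $P_2$ and $t$ copies of $K_2$. For a subgraph $H$ of $K_m$, $K_m-H$ is the graph obtained from $K_m$ by deleting the edges of $H$; here $kP_2\cup tK_2$ is regarded as a subgraph of $K_{r+1}$. *)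

theory Defs
  imports Main
begin

datatype 'a graph = Graph (verts: "'a set") (edges: "'a set set")

definition simple_graph :: "'a graph \<Rightarrow> bool" where
  "simple_graph G \<longleftrightarrow>
     finite (verts G) \<and> (\<forall>e\<in>edges G. e \<subseteq> verts G \<and> card e = 2)"

definition degree :: "'a graph \<Rightarrow> 'a \<Rightarrow> nat" where
  "degree G v = card {e \<in> edges G. v \<in> e}"

definition subgraph :: "'a graph \<Rightarrow> 'a graph \<Rightarrow> bool" where
  "subgraph H G \<longleftrightarrow> simple_graph H \<and> verts H \<subseteq> verts G \<and> edges H \<subseteq> edges G"

definition isomorphic :: "'a graph \<Rightarrow> 'b graph \<Rightarrow> bool" where
  "isomorphic G H \<longleftrightarrow>
     (\<exists>f. bij_betw f (verts G) (verts H) \<and> (\<lambda>e. f ` e) ` edges G = edges H)"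

text \<open>``\<open>G\<close> contains \<open>F\<close> as a subgraph'' refers to some, not necessarily induced,
  isomorphic copy of \<open>F\<close> inside \<open>G\<close>.\<close>

definition contains_copy :: "'b graph \<Rightarrow> 'a graph \<Rightarrow> bool" where
  "contains_copy G F \<longleftrightarrow> (\<exists>F'. subgraph F' G \<and> isomorphic F F')"

definition complete_graph :: "nat \<Rightarrow> nat graph" where
  "complete_graph m = Graph {..<m} {e. e \<subseteq> {..<m} \<and> card e = 2}"

text \<open>The index of a path counts its edges, so \<open>path_graph 2\<close> has three vertices.\<close>

definition path_graph :: "nat \<Rightarrow> nat graph" where
  "path_graph m = Graph {..m} {{i, Suc i} | i. i < m}"

definition disjoint_union :: "'a graph \<Rightarrow> 'b graph \<Rightarrow> ('a + 'b) graph" where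
  "disjoint_union G H =
     Graph (verts G <+> verts H)
           ((\<lambda>e. Inl ` e) ` edges G \<union> (\<lambda>e. Inr ` e) ` edges H)"

definition copies :: "nat \<Rightarrow> 'a graph \<Rightarrow> (nat \<times> 'a) graph" where
  "copies k G = Graph ({..<k} \<times> verts G) {Pair i ` e | i e. i < k \<and> e \<in> edges G}"

definition delete_edges :: "'a graph \<Rightarrow> 'a graph \<Rightarrow> 'a graph" where
  "delete_edges G H = Graph (verts G) (edges G - edges H)"

text \<open>Up to isomorphism, the vertices of a realization of \<open>(d\<^sub>1, \<dots>, d\<^sub>n)\<close> are
  numbered so that the vertex with index \<open>i\<close> has the \<open>i\<close>-th degree; list indices start
  at \<open>0\<close>.\<close>

definition realization :: "nat list \<Rightarrow> nat graph \<Rightarrow> bool" where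
  "realization \<pi> G \<longleftrightarrow>
     simple_graph G \<and> verts G = {..<length \<pi>} \<and> (\<forall>i<length \<pi>. degree G i = \<pi> ! i)"

definition graphic :: "nat list \<Rightarrow> bool" where
  "graphic \<pi> \<longleftrightarrow> sorted_wrt (\<ge>) \<pi> \<and> (\<exists>G. realization \<pi> G)"

definition potentially_graphic :: "'a graph \<Rightarrow> nat list \<Rightarrow> bool" where
  "potentially_graphic F \<pi> \<longleftrightarrow> (\<exists>G. realization \<pi> G \<and> contains_copy G F)"

text \<open>Large bounds \<open>l\<close> qualify vacuously, so the least one exists as soon as some
  \<open>n\<close>-term graphic sequence is not potentially \<open>F\<close>-graphic; otherwise every even integer
  qualifies and the value is unspecified.\<close>

definition sigma :: "'a graph \<Rightarrow> nat \<Rightarrow> int" where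
  "sigma F n = (LEAST l. even l \<and>
     (\<forall>\<pi>. graphic \<pi> \<and> length \<pi> = n \<and> int (sum_list \<pi>) \<ge> l \<longrightarrow> potentially_graphic F \<pi>))"

end

theory Submission
  imports Defs
begin

text \<open>
  Put \<open>p = r - 2\<close>; the claimed value is \<open>p (2 n - p - 1) + 2\<close>. The join of \<open>K\<^sub>p\<close> with \<open>n - p\<close> isolated
  vertices is the only realization of its degree sequence, whose sum is \<open>p (2 n - p - 1)\<close>. A copy of
  \<open>K\<^bsub>r+1\<^esub> - H\<close> in it would have three vertices in the independent part, hence a triangle in \<open>H\<close>.

  Conversely, let \<open>\<pi>\<close> be graphic with sum at least \<open>p (2 n - p - 1) + 2\<close>. If \<open>d\<^sub>p \<le> p + 1\<close>, then \<open>\<pi>\<close> consists of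
  \<open>p - 1\<close> terms \<open>n - 1\<close> and \<open>n - p + 1\<close> terms \<open>p + 1\<close>, and the join of \<open>K\<^bsub>p-1\<^esub>\<close> with a 4-cycle and another cycle
  is a realization containing \<open>K\<^bsub>r+1\<^esub> - 2K\<^sub>2\<close>. Otherwise \<open>\<pi>\<close> even has a realization whose first \<open>r + 1\<close> vertices
  span \<open>T = K\<^bsub>r+1\<^esub> - P\<^sub>2\<close>. By an \<open>f\<close>-factor theorem this is a matter of inequalities: every disjoint pair
  \<open>(P, Q)\<close> must have slack \<open>|P| (n - 1 - |Q|) + d(Q) - d(P)\<close> at least the number of pairs of \<open>T\<close> that lead
  from outside \<open>P\<close> into \<open>Q\<close>. All slacks are nonnegative since \<open>\<pi>\<close> is graphic. Moving the part of \<open>Q\<close>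
  among the first \<open>r + 1\<close> vertices and the part of \<open>P\<close> beyond them to the complement of \<open>P \<union> Q\<close> settles all
  cases but those where these parts are small; there the bound on the degree sum makes the slack of the
  remaining pair large.
\<close>

section \<open>Signed trails\<close>

definition pair_ind :: "'a \<Rightarrow> 'a \<Rightarrow> 'a \<Rightarrow> 'a \<Rightarrow> int" where
  "pair_ind u v a b = (if a = u \<and> b = v \<or> a = v \<and> b = u then 1 else 0)"

lemma pair_ind_sym: "pair_ind u v a b = pair_ind u v b a"
  by (auto simp: pair_ind_def)

lemma sum_pair_ind:
  assumes "finite V" "u \<in> V" "v \<in> V" "u \<noteq> v"
  shows "(\<Sum>b\<in>V. pair_ind u v a b) = of_bool (a = u) + of_bool (a = v)"
proof -
  have "pair_ind u v a b = (if b = v then of_bool (a = u) else 0) + (if b = u then of_bool (a = v) else 0)" for b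
    using assms(4) by (auto simp: pair_ind_def)
  then show ?thesis using assms by (simp add: sum.distrib)
qed

text \<open>The signs \<open>1\<close> and \<open>- 1\<close> alternate along the edges of a trail in \<open>N\<close>, so that they cancel at
  every vertex except possibly at its ends; trails themselves are never mentioned.\<close>

definition signing :: "('a \<times> 'a) set \<Rightarrow> ('a \<Rightarrow> 'a \<Rightarrow> int) \<Rightarrow> bool" where
  "signing N D \<longleftrightarrow> (\<forall>a b. D a b = D b a) \<and> (\<forall>a b. D a b \<in> {- 1, 0, 1})
     \<and> (\<forall>a b. (a, b) \<notin> N \<longrightarrow> D a b = 0)"

lemma signing_mono: "signing N D \<Longrightarrow> N \<subseteq> M \<Longrightarrow> signing M D"
  unfolding signing_def by blast

text \<open>Prepending the edge \<open>u v\<close> to an alternating trail flips the signs of all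
  its edges. The trail avoids that edge, so the entries stay in {-1, 0, 1}.\<close>

lemma signing_extend:
  assumes "signing (N - {(u, v), (v, u)}) D" "(u, v) \<in> N" "sym N"
  shows "signing N (\<lambda>a b. pair_ind u v a b - D a b)"
  using assms unfolding signing_def pair_ind_def sym_def by auto

lemma card_Image_remove_edge:
  assumes "finite N" "sym N" "irrefl N" "(u, v) \<in> N"
  defines "M \<equiv> N - {(u, v), (v, u)}"
  shows "card (N `` {a}) = card (M `` {a}) + of_bool (a = u \<or> a = v)"
proof -
  have ne: "u \<noteq> v" using assms by (auto simp: irrefl_def)
  have vu: "(v, u) \<in> N" using assms by (auto dest: symD)
  have "N `` {a} = (if a = u then insert v (M `` {a}) else if a = v then insert u (M `` {a}) else M `` {a})"
    using ne assms(4) vu by (auto simp: M_def)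
  moreover have "v \<notin> M `` {u}" "u \<notin> M `` {v}" by (auto simp: M_def)
  moreover have "finite (M `` {a})" using assms(1) by (auto simp: M_def intro: finite_Image)
  ultimately show ?thesis by auto
qed

lemma sym_remove_edge: "sym N \<Longrightarrow> sym (N - {(u, v), (v, u)})"
  by (auto simp: sym_def)

lemma open_trail_signing:
  assumes "finite V" "N \<subseteq> V \<times> V" "sym N" "irrefl N" "u \<noteq> v"
    and "\<And>a. odd (card (N `` {a})) \<longleftrightarrow> a = u \<or> a = v"
  shows "\<exists>D s. signing N D \<and> s \<in> {1, - 1} \<and>
           (\<forall>a. (\<Sum>b\<in>V. D a b) = of_bool (a = u) + s * of_bool (a = v))"
  using assms(2-)
proof (induction "card N" arbitrary: N u rule: less_induct)
  case less
  have fin: "finite N" using less.prems(1) assms(1) finite_subset by blast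
  have "odd (card (N `` {u}))" using less.prems(5) by simp
  then have "N `` {u} \<noteq> {}" by (metis card.empty even_zero)
  then obtain u' where u': "(u, u') \<in> N" by auto
  define M where "M = N - {(u, u'), (u', u)}"
  have ne: "u \<noteq> u'" using u' less.prems(3) by (auto simp: irrefl_def)
  have V: "u \<in> V" "u' \<in> V" using u' less.prems(1) by auto
  have cM: "card (N `` {a}) = card (M `` {a}) + of_bool (a = u \<or> a = u')" for a
    using card_Image_remove_edge[OF fin less.prems(2,3) u'] by (simp add: M_def)
  show ?case
  proof (cases "u' = v")
    case True
    have "signing N (pair_ind u v)"
      using u' True less.prems(2) by (auto simp: signing_def pair_ind_def sym_def)
    moreover have "\<forall>a. (\<Sum>b\<in>V. pair_ind u v a b) = of_bool (a = u) + 1 * of_bool (a = v)"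
      using sum_pair_ind[OF assms(1)] V ne True by simp
    ultimately show ?thesis by blast
  next
    case False
    have odd: "odd (card (M `` {a})) \<longleftrightarrow> a = u' \<or> a = v" for a
      using cM[of a] less.prems(5)[of a] ne False less.prems(4) by (cases "a = u"; cases "a = u'") auto
    have "card M < card N" using fin u' by (auto simp: M_def intro!: psubset_card_mono)
    moreover have "M \<subseteq> V \<times> V" "sym M" "irrefl M"
      using less.prems(1-3) sym_remove_edge by (auto simp: M_def irrefl_def)
    ultimately obtain D s where D: "signing M D" "s \<in> {1, - 1}"
      "\<forall>a. (\<Sum>b\<in>V. D a b) = of_bool (a = u') + s * of_bool (a = v)"
      using less.hyps[of M u'] False odd by blast
    have "signing N (\<lambda>a b. pair_ind u u' a b - D a b)"
      using signing_extend D(1) u' less.prems(2) by (simp add: M_def)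
    moreover have "(\<Sum>b\<in>V. pair_ind u u' a b - D a b) = of_bool (a = u) + (- s) * of_bool (a = v)" for a
      using sum_pair_ind[OF assms(1) V ne] D(3) by (simp add: sum_subtractf)
    moreover have "- s \<in> {1, - 1}" using D(2) by auto
    ultimately show ?thesis by blast
  qed
qed

text \<open>Without the edge \<open>u v\<close> the odd vertices are \<open>v\<close> and
  \<open>u\<close>, and an open trail from \<open>v\<close> back to \<open>u\<close> closes up. At
  the start, the first and the last sign cancel if the closed trail has even length and add up to 2
  if it is odd.\<close>

lemma closed_trail_signing:
  assumes "finite V" "N \<subseteq> V \<times> V" "sym N" "irrefl N" "(u, v) \<in> N"
    and "\<And>a. even (card (N `` {a}))"
  shows "\<exists>D c. signing N D \<and> D u v = 1 \<and> c \<in> {0, 2} \<and> (\<forall>a. (\<Sum>b\<in>V. D a b) = c * of_bool (a = u))"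
proof -
  define M where "M = N - {(u, v), (v, u)}"
  have fin: "finite N" using assms(1,2) finite_subset by blast
  have ne: "u \<noteq> v" using assms(4,5) by (auto simp: irrefl_def)
  have V: "u \<in> V" "v \<in> V" using assms by auto
  have cM: "card (N `` {a}) = card (M `` {a}) + of_bool (a = u \<or> a = v)" for a
    using card_Image_remove_edge[OF fin assms(3-5)] by (simp add: M_def)
  have "odd (card (M `` {a})) \<longleftrightarrow> a = v \<or> a = u" for a
    using cM[of a] assms(6)[of a] by (cases "a = u \<or> a = v") auto
  moreover have "M \<subseteq> V \<times> V" "sym M" "irrefl M"
    using assms sym_remove_edge by (auto simp: M_def irrefl_def)
  ultimately obtain D s where D: "signing M D" "s \<in> {1, - 1}"
      "\<forall>a. (\<Sum>b\<in>V. D a b) = of_bool (a = v) + s * of_bool (a = u)"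
    using open_trail_signing[OF assms(1), of M v u] ne by blast
  have "signing N (\<lambda>a b. pair_ind u v a b - D a b)"
    using signing_extend D(1) assms(3,5) by (simp add: M_def)
  moreover have "(\<Sum>b\<in>V. pair_ind u v a b - D a b) = (1 - s) * of_bool (a = u)" for a
    using sum_pair_ind[OF assms(1) V ne] D(3) by (simp add: sum_subtractf algebra_simps)
  moreover have "1 - s \<in> {0, 2}" using D(2) by auto
  moreover have "pair_ind u v u v - D u v = 1"
    using D(1) by (auto simp: signing_def M_def pair_ind_def)
  ultimately show ?thesis by blast
qed

definition supp :: "('a \<Rightarrow> 'a \<Rightarrow> int) \<Rightarrow> ('a \<times> 'a) set" where
  "supp D = {(a, b). D a b \<noteq> 0}"

lemma signing_supp: "signing N D \<Longrightarrow> supp D \<subseteq> N \<and> sym (supp D)"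
  unfolding signing_def supp_def sym_def by auto

text \<open>The entries of a signing are odd exactly where they are nonzero, so row sum and degree
  in the support agree modulo 2.\<close>

lemma even_card_supp:
  assumes "finite V" "N \<subseteq> V \<times> V" "signing N D" "even (\<Sum>b\<in>V. D a b)"
  shows "even (card (supp D `` {a}))"
proof -
  have "b \<in> V" if "D a b \<noteq> 0" for b
    using assms(2,3) that unfolding signing_def by blast
  then have "supp D `` {a} = {b\<in>V. D a b \<noteq> 0}"
    by (auto simp: supp_def)
  then have "int (card (supp D `` {a})) = (\<Sum>b\<in>V. of_bool (D a b \<noteq> 0))"
    using assms(1) by (simp add: Int_def)
  also have "even \<dots> \<longleftrightarrow> even (\<Sum>b\<in>V. D a b)"
  proof -
    have "even (D a b) \<longleftrightarrow> even (of_bool (D a b \<noteq> 0) :: int)" for b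
    proof -
      have "D a b \<in> {- 1, 0, 1}" using assms(3) by (simp add: signing_def)
      then show ?thesis by auto
    qed
    then have "even ((\<Sum>b\<in>V. of_bool (D a b \<noteq> 0)) - (\<Sum>b\<in>V. D a b))"
      unfolding sum_subtractf[symmetric] by (intro dvd_sum) (simp add: even_diff)
    then show ?thesis by (simp add: even_diff)
  qed
  finally show ?thesis using assms(4) by simp
qed

text \<open>The support of \<open>D\<close> has even degrees, so a closed trail inside it can start
  with any of its edges. This moves the base of an odd closed trail; the new trail may use only a
  part of the support.\<close>

lemma signing_recenter:
  assumes "finite V" "N \<subseteq> V \<times> V" "irrefl N" "signing N D"
    and "\<And>a. even (\<Sum>b\<in>V. D a b)" "D u v \<noteq> 0"
  shows "\<exists>D' c. signing (supp D) D' \<and> D' u v = 1 \<and> c \<in> {0, 2} \<and>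
           (\<forall>a. (\<Sum>b\<in>V. D' a b) = c * of_bool (a = u))"
proof (rule closed_trail_signing[OF assms(1)])
  show "supp D \<subseteq> V \<times> V" "sym (supp D)" "irrefl (supp D)"
    using signing_supp[OF assms(4)] assms(2,3) by (auto simp: irrefl_def)
  show "(u, v) \<in> supp D" using assms(6) by (simp add: supp_def)
  show "even (card (supp D `` {a}))" for a
    using even_card_supp[OF assms(1,2,4)] assms(5) by blast
qed

text \<open>In a bipartite graph the two sides have equal total sign, so an odd closed trail, whose signs
  sum to 2 at its start and to 0 elsewhere, does not fit.\<close>

lemma odd_signing_not_bipartite:
  assumes "finite V" "N \<subseteq> V \<times> V" "signing N D" "u \<in> V"
    and "\<forall>a. (\<Sum>b\<in>V. D a b) = 2 * of_bool (a = u)"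
    and bip: "\<And>a b. D a b \<noteq> 0 \<Longrightarrow> col a \<noteq> (col b :: bool)"
  shows False
proof -
  define X where "X = {a\<in>V. col a}"
  define Y where "Y = {a\<in>V. \<not> col a}"
  have fin: "finite X" "finite Y" using assms(1) by (auto simp: X_def Y_def)
  have sX: "(\<Sum>b\<in>V. D a b) = (\<Sum>b\<in>Y. D a b)" if "a \<in> X" for a
    using bip that assms(1) by (intro sum.mono_neutral_right) (auto simp: X_def Y_def)
  have sY: "(\<Sum>b\<in>V. D a b) = (\<Sum>b\<in>X. D a b)" if "a \<in> Y" for a
    using bip that assms(1) by (intro sum.mono_neutral_right) (auto simp: X_def Y_def)
  have "(\<Sum>a\<in>X. 2 * of_bool (a = u)) = (\<Sum>a\<in>X. \<Sum>b\<in>Y. D a b)"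
    using sX assms(5) by simp
  also have "\<dots> = (\<Sum>b\<in>Y. \<Sum>a\<in>X. D b a)"
    using assms(3) by (subst sum.swap) (simp add: signing_def)
  also have "\<dots> = (\<Sum>a\<in>Y. 2 * of_bool (a = u))"
    using sY assms(5) by simp
  finally have "(\<Sum>a\<in>X. 2 * of_bool (a = u)) = (\<Sum>a\<in>Y. 2 * of_bool (a = u) :: int)" .
  moreover have "(\<Sum>a\<in>Z. 2 * of_bool (a = u)) = (if u \<in> Z then 2 else 0 :: int)" if "finite Z" for Z
    using that by (simp add: of_bool_def sum.delta if_distrib[of "(*) 2"] cong: if_cong)
  ultimately show False using fin assms(4) by (auto simp: X_def Y_def split: if_splits)
qed

text \<open>\<open>w\<close> is twice a half-integral factor with degrees \<open>d\<close>, and its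
  ones form a graph with even degrees. A closed trail of even length in that graph can be rounded at
  once. If there is none, every closed trail is odd and hence leaves \<open>S\<close>, where the
  ones are bipartite; then two edge-disjoint odd trails with bases \<open>v1\<close> and
  \<open>v2\<close> outside \<open>S\<close> are rounded together, the entry at \<open>v1 v2\<close>
  absorbing the error 2 at both bases. So entries other than ones change only outside
  \<open>S\<close>.\<close>

lemma half_integral_improve:
  fixes w :: "'a \<Rightarrow> 'a \<Rightarrow> int" and d :: "'a \<Rightarrow> int"
  assumes V: "finite V"
    and w_sym: "\<And>a b. w a b = w b a" and w_irr: "\<And>a. w a a = 0"
    and w_V: "\<And>a b. w a b \<noteq> 0 \<Longrightarrow> a \<in> V \<and> b \<in> V"
    and w_val: "\<And>a b. w a b \<in> {0, 1, 2}"
    and w_sum: "\<And>a. a \<in> V \<Longrightarrow> (\<Sum>b\<in>V. w a b) = 2 * d a"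
    and even: "even (\<Sum>a\<in>V. d a)"
    and col: "\<And>a b. a \<in> S \<Longrightarrow> b \<in> S \<Longrightarrow> w a b = 1 \<Longrightarrow> col a \<noteq> (col b :: bool)"
    and N: "(x, y) \<in> N" "N = {(a, b). w a b = 1}"
  shows "\<exists>E. (\<forall>a b. E a b = E b a) \<and> (\<forall>a b. E a b = 0 \<or> w a b + E a b \<in> {0, 2}) \<and>
     (\<forall>a\<in>V. (\<Sum>b\<in>V. E a b) = 0) \<and> (\<forall>a. E a a = 0) \<and>
     (\<forall>a b. E a b \<noteq> 0 \<longrightarrow> w a b = 1 \<or> a \<in> V - S \<and> b \<in> V - S) \<and> (\<exists>a b. w a b = 1 \<and> E a b \<noteq> 0)"
    (is "\<exists>E. ?good E")
proof (rule ccontr)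
  assume contra: "\<not> (\<exists>E. ?good E)"
  have NV: "N \<subseteq> V \<times> V"
  proof
    fix e assume "e \<in> N"
    then obtain a b where "e = (a, b)" "w a b = 1" using N(2) by auto
    then show "e \<in> V \<times> V" using w_V[of a b] by simp
  qed
  have symN: "sym N" using w_sym N(2) by (auto simp: sym_def)
  have irrN: "irrefl N" using w_irr N(2) by (auto simp: irrefl_def)
  have finN: "finite N" using NV V finite_subset by blast
  have Nw: "w a b = 1" if "signing N D" "D a b \<noteq> 0" for D a b
    using that N(2) by (auto simp: signing_def)
  have good1: "?good D" if "signing N D" "\<forall>a. (\<Sum>b\<in>V. D a b) = 0" "D a b \<noteq> 0" for D a b
  proof (intro conjI)
    show "\<forall>a b. D a b = 0 \<or> w a b + D a b \<in> {0, 2}"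
    proof (intro allI)
      fix a b
      have "D a b \<in> {- 1, 0, 1}" using that(1) by (simp add: signing_def)
      then show "D a b = 0 \<or> w a b + D a b \<in> {0, 2}" using Nw[OF that(1), of a b] by auto
    qed
    show "\<forall>a. D a a = 0"
    proof
      fix a show "D a a = 0" using Nw[OF that(1), of a a] w_irr[of a] by auto
    qed
    show "\<forall>a b. D a b \<noteq> 0 \<longrightarrow> w a b = 1 \<or> a \<in> V - S \<and> b \<in> V - S"
      using Nw[OF that(1)] by blast
    show "\<exists>a b. w a b = 1 \<and> D a b \<noteq> 0" using Nw[OF that(1)] that(3) by blast
    show "\<forall>a b. D a b = D b a" using that(1) unfolding signing_def by (rule conjunct1)
    show "\<forall>a\<in>V. (\<Sum>b\<in>V. D a b) = 0" using that(2) by simp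
  qed
  have no_even: False if "signing N D" "\<forall>a. (\<Sum>b\<in>V. D a b) = 0" "D a b \<noteq> 0" for D a b
    by (rule notE[OF contra exI]) (rule good1[OF that])
  have evenN: "even (card (N `` {a}))" for a
  proof (cases "a \<in> V")
    case True
    have "b \<in> V" if "w a b = 1" for b using w_V[of a b] that by simp
    then have "N `` {a} = {b\<in>V. w a b = 1}" using N(2) by auto
    then have "int (card (N `` {a})) = (\<Sum>b\<in>V. of_bool (w a b = 1))"
      using V by (simp add: Int_def)
    also have "even \<dots> \<longleftrightarrow> even (\<Sum>b\<in>V. w a b)"
    proof -
      have "even (w a b) \<longleftrightarrow> even (of_bool (w a b = 1) :: int)" for b
        using w_val[of a b] by auto
      then have "even ((\<Sum>b\<in>V. of_bool (w a b = 1)) - (\<Sum>b\<in>V. w a b))"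
        unfolding sum_subtractf[symmetric] by (intro dvd_sum) (simp add: even_diff)
      then show ?thesis by (simp add: even_diff)
    qed
    finally show ?thesis using w_sum[OF True] by simp
  next
    case False
    then have "N `` {a} = {}" using NV by auto
    then show ?thesis by simp
  qed
  \<comment> \<open>Two edge-disjoint odd closed trails with the same start would combine to an even one.\<close>
  have disj: "D v b = 0 \<or> D' v b' = 0"
    if "signing N D" "signing N D'" "supp D \<inter> supp D' = {}"
      "\<forall>a. (\<Sum>b\<in>V. D a b) = 2 * of_bool (a = v)" "\<forall>a. (\<Sum>b\<in>V. D' a b) = 2 * of_bool (a = v)" for D D' v b b'
  proof (rule ccontr)
    assume as: "\<not> ?thesis"
    have ex: "D a b = 0 \<or> D' a b = 0" for a b using that(3) by (auto simp: supp_def)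
    have "signing N (\<lambda>a b. D a b - D' a b)"
      unfolding signing_def
    proof (intro conjI allI impI)
      fix a b
      have "D a b \<in> {- 1, 0, 1}" "D' a b \<in> {- 1, 0, 1}"
        using that(1,2) by (simp_all add: signing_def)
      then show "D a b - D' a b \<in> {- 1, 0, 1}" using ex[of a b] by auto
      show "D a b - D' a b = D b a - D' b a"
        using that(1,2) unfolding signing_def by metis
      show "D a b - D' a b = 0" if "(a, b) \<notin> N"
        using that \<open>signing N D\<close> \<open>signing N D'\<close> by (simp add: signing_def)
    qed
    moreover have "\<exists>b. D v b - D' v b \<noteq> 0" using as ex[of v] by (metis diff_zero diff_0 neg_equal_0_iff_equal)
    moreover have "\<forall>a. (\<Sum>b\<in>V. D a b - D' a b) = 0" using that(4,5) by (simp add: sum_subtractf)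
    ultimately show False using no_even by blast
  qed
  have odd_trail: "\<exists>D v b. signing M D \<and> v \<in> V - S \<and> D v b \<noteq> 0 \<and> (\<forall>a. (\<Sum>b\<in>V. D a b) = 2 * of_bool (a = v))"
    if M: "M \<subseteq> N" "sym M" "\<And>a. even (card (M `` {a}))" "(u, u') \<in> M" for M u u'
  proof -
    have MV: "M \<subseteq> V \<times> V" "irrefl M" using M NV irrN by (auto simp: irrefl_def)
    obtain D c where D: "signing M D" "D u u' = 1" "c \<in> {0, 2}" "\<forall>a. (\<Sum>b\<in>V. D a b) = c * of_bool (a = u)"
      using closed_trail_signing[OF V MV(1) M(2) MV(2) M(4,3)] by blast
    have DN: "signing N D" using D(1) M(1) signing_mono by blast
    have "c = 2" using no_even[OF DN, of u u'] D(2-4) by auto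
    have "\<exists>v b. v \<in> V - S \<and> D v b \<noteq> 0"
    proof (rule ccontr)
      assume no: "\<not> ?thesis"
      have "a \<in> S \<and> b \<in> S" if "D a b \<noteq> 0" for a b
      proof -
        have "D b a \<noteq> 0" using that D(1) by (simp add: signing_def)
        moreover have "a \<in> V" "b \<in> V" using Nw[OF DN that] w_V[of a b] by auto
        ultimately show ?thesis using no that by blast
      qed
      then have "col a \<noteq> col b" if "D a b \<noteq> 0" for a b
        using that col Nw[OF DN] by blast
      moreover have "u \<in> V" using M(4) MV(1) by auto
      ultimately show False
        using odd_signing_not_bipartite[OF V MV(1) D(1), of u col] D(4) \<open>c = 2\<close> by simp
    qed
    then obtain v b where v: "v \<in> V - S" "D v b \<noteq> 0" by blast
    \<comment> \<open>The trail rebased at \<open>v\<close> is odd again, since an even one would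
      have vanishing row sums.\<close>
    obtain D' c' where D': "signing (supp D) D'" "D' v b = 1" "c' \<in> {0, 2}" "\<forall>a. (\<Sum>b\<in>V. D' a b) = c' * of_bool (a = v)"
      using signing_recenter[OF V MV(1,2) D(1) _ v(2)] D(4) \<open>c = 2\<close> by auto
    have D'M: "signing M D'" using D'(1) signing_supp[OF D(1)] signing_mono by blast
    then have "signing N D'" using M(1) signing_mono by blast
    then have "c' = 2" using no_even[of D' v b] D'(2-4) by auto
    then show ?thesis using D'M v(1) D'(2,4) by (metis one_neq_zero)
  qed
  obtain D1 v1 b1 where D1: "signing N D1" "v1 \<in> V - S" "D1 v1 b1 \<noteq> 0" "\<forall>a. (\<Sum>b\<in>V. D1 a b) = 2 * of_bool (a = v1)"
    using odd_trail[OF _ symN evenN N(1)] by auto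
  define M where "M = N - supp D1"
  have s1: "supp D1 \<subseteq> N" "sym (supp D1)" using signing_supp[OF D1(1)] by auto
  have symM: "sym M" using s1 symN by (auto simp: M_def sym_def)
  have evenM: "even (card (M `` {a}))" for a
  proof -
    have "M `` {a} = N `` {a} - supp D1 `` {a}" by (auto simp: M_def)
    then have "card (M `` {a}) = card (N `` {a}) - card (supp D1 `` {a})"
      using s1 finN by (simp add: card_Diff_subset Image_mono finite_Image finite_subset)
    moreover have "even (card (supp D1 `` {a}))"
      using even_card_supp[OF V NV D1(1)] D1(4) by simp
    ultimately show ?thesis using evenN[of a] by simp
  qed
  have "M \<noteq> {}"
  proof
    assume "M = {}"
    \<comment> \<open>So the ones of \<open>w\<close> form a single odd trail, against the parity of the degree sum.\<close>
    then have "N = supp D1" using s1 by (auto simp: M_def)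
    have "4 dvd (2 * (\<Sum>a\<in>V. d a))" using even by auto
    also have "2 * (\<Sum>a\<in>V. d a) = (\<Sum>a\<in>V. \<Sum>b\<in>V. w a b)"
      using w_sum by (simp add: sum_distrib_left)
    finally have 4: "4 dvd (\<Sum>a\<in>V. \<Sum>b\<in>V. w a b)" .
    \<comment> \<open>Modulo 2, \<open>w\<close> agrees with \<open>D1\<close>. The matrix
      \<open>h\<close> is symmetric with zero diagonal, so its total is even and the total of
      \<open>w\<close> is 2 modulo 4.\<close>
    define h where "h = (\<lambda>a b. (w a b - D1 a b) div 2)"
    have h: "w a b = D1 a b + 2 * h a b" for a b
    proof -
      have "w a b = 1 \<longleftrightarrow> D1 a b \<noteq> 0" using \<open>N = supp D1\<close> N(2) by (auto simp: supp_def)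
      moreover have "D1 a b \<in> {- 1, 0, 1}" using D1(1) by (simp add: signing_def)
      ultimately have "even (w a b - D1 a b)" using w_val[of a b] by auto
      then show ?thesis by (simp add: h_def)
    qed
    have hs: "h a b = h b a" for a b
      using w_sym D1(1) by (simp add: h_def signing_def)
    have h0: "h a a = 0" for a
    proof -
      have "D1 a a = 0" using w_irr[of a] Nw[OF D1(1), of a a] by linarith
      then show ?thesis using w_irr[of a] by (simp add: h_def)
    qed
    have "even (\<Sum>a\<in>V. \<Sum>b\<in>V. h a b)"
      using V
    proof (induction V rule: finite_induct)
      case (insert x F)
      have "(\<Sum>a\<in>insert x F. \<Sum>b\<in>insert x F. h a b) =
          h x x + (\<Sum>b\<in>F. h x b) + ((\<Sum>a\<in>F. h a x) + (\<Sum>a\<in>F. \<Sum>b\<in>F. h a b))"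
        using insert.hyps by (simp add: sum.distrib)
      also have "(\<Sum>a\<in>F. h a x) = (\<Sum>b\<in>F. h x b)" using hs by metis
      finally show ?case using insert.IH h0 by simp
    qed simp
    moreover have "(\<Sum>a\<in>V. \<Sum>b\<in>V. w a b) = 2 + 2 * (\<Sum>a\<in>V. \<Sum>b\<in>V. h a b)"
    proof -
      have "(\<Sum>a\<in>V. \<Sum>b\<in>V. w a b) = (\<Sum>a\<in>V. 2 * of_bool (a = v1)) + 2 * (\<Sum>a\<in>V. \<Sum>b\<in>V. h a b)"
        using D1(4) by (simp add: h sum.distrib sum_distrib_left)
      moreover have "(\<Sum>a\<in>V. 2 * of_bool (a = v1)) = (2 :: int)"
        using V D1(2) by (simp add: of_bool_def sum.delta if_distrib[of "(*) 2"] cong: if_cong)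
      ultimately show ?thesis by simp
    qed
    moreover have "even y \<Longrightarrow> x = 2 + 2 * y \<Longrightarrow> \<not> 4 dvd x" for x y :: int by presburger
    ultimately show False using 4 by blast
  qed
  then obtain u u' where "(u, u') \<in> M" by auto
  then obtain D2 v2 b2 where D2: "signing M D2" "v2 \<in> V - S" "D2 v2 b2 \<noteq> 0" "\<forall>a. (\<Sum>b\<in>V. D2 a b) = 2 * of_bool (a = v2)"
    using odd_trail[of M, OF _ symM evenM] M_def by blast
  have D2N: "signing N D2" using D2(1) signing_mono M_def by blast
  have s12: "supp D1 \<inter> supp D2 = {}" using signing_supp[OF D2(1)] by (auto simp: M_def)
  have "v1 \<noteq> v2" using disj[OF D1(1) D2N s12 D1(4)] D2(3,4) D1(3) by blast
  have all: "(v, b) \<in> supp D" 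
    if "(v, b) \<in> N" "signing N D" "\<forall>a. (\<Sum>b\<in>V. D a b) = 2 * of_bool (a = v)" "D v b' \<noteq> 0" for v b b' D
  proof (rule ccontr)
    assume no: "(v, b) \<notin> supp D"
    have sD: "supp D \<subseteq> N" "sym (supp D)" using signing_supp[OF that(2)] by auto
    define L where "L = N - supp D"
    have "sym L" using sD symN by (auto simp: L_def sym_def)
    moreover have "even (card (L `` {a}))" for a
    proof -
      have "L `` {a} = N `` {a} - supp D `` {a}" by (auto simp: L_def)
      then have "card (L `` {a}) = card (N `` {a}) - card (supp D `` {a})"
        using sD finN by (simp add: card_Diff_subset Image_mono finite_Image finite_subset)
      moreover have "even (card (supp D `` {a}))"
        using even_card_supp[OF V NV that(2)] that(3) by simp
      ultimately show ?thesis using evenN[of a] by simp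
    qed
    moreover have "L \<subseteq> V \<times> V" "irrefl L" "(v, b) \<in> L"
      using NV irrN that(1) no by (auto simp: L_def irrefl_def)
    ultimately obtain D' c where D': "signing L D'" "D' v b = 1" "c \<in> {0, 2}" "\<forall>a. (\<Sum>b\<in>V. D' a b) = c * of_bool (a = v)"
      using closed_trail_signing[OF V, of L v b] by blast
    have D'N: "signing N D'" using D'(1) signing_mono L_def by blast
    have "c = 2" using no_even[OF D'N, of v b] D'(2-4) by auto
    moreover have "supp D \<inter> supp D' = {}" using signing_supp[OF D'(1)] by (auto simp: L_def)
    ultimately show False using disj[OF that(2) D'N _ that(3)] D' that(4) by fastforce
  qed
  have not1: "w v1 v2 \<noteq> 1"
  proof
    assume "w v1 v2 = 1"
    then have "(v1, v2) \<in> N" "(v2, v1) \<in> N" using N(2) w_sym by auto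
    then have "(v1, v2) \<in> supp D1" "(v2, v1) \<in> supp D2"
      using all D1 D2N D2 by blast+
    then show False using s12 s1 by (auto dest: symD)
  qed
  then have w12: "w v1 v2 = 0 \<or> w v1 v2 = 2" using w_val[of v1 v2] by auto
  \<comment> \<open>The entry at \<open>v1 v2\<close> is raised from 0 to 2 or lowered from 2 to 0;
    \<open>s\<close> is the sign of this change, and the two trails compensate for it.\<close>
  define s where "s = (1 - w v1 v2)"
  have s: "s \<in> {1, - 1}" using w12 by (auto simp: s_def)
  define E where "E = (\<lambda>a b. 2 * s * pair_ind v1 v2 a b - s * D1 a b - s * D2 a b)"
  have p0: "D1 a b = 0 \<and> D2 a b = 0" if "pair_ind v1 v2 a b \<noteq> 0" for a b
  proof -
    have "w a b \<noteq> 1" using that not1 w_sym[of v1 v2] by (auto simp: pair_ind_def split: if_splits)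
    then show ?thesis using Nw[OF D1(1)] Nw[OF D2N] by blast
  qed
  have ex: "D1 a b = 0 \<or> D2 a b = 0" for a b using s12 by (auto simp: supp_def)
  have "?good E"
  proof (intro conjI allI)
    fix a b
    show "E a b = E b a" using D1(1) D2(1) pair_ind_sym[of v1 v2 a b] by (simp add: E_def signing_def)
    show "E a b = 0 \<or> w a b + E a b \<in> {0, 2}"
    proof (cases "pair_ind v1 v2 a b = 0")
      case True
      have "D1 a b \<in> {- 1, 0, 1}" "D2 a b \<in> {- 1, 0, 1}"
        using D1(1) D2(1) by (simp_all add: signing_def)
      then show ?thesis
        using True ex[of a b] Nw[OF D1(1), of a b] Nw[OF D2N, of a b] s by (auto simp: E_def)
    next
      case False
      then have "w a b = w v1 v2" "pair_ind v1 v2 a b = 1"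
        using w_sym[of v1 v2] by (auto simp: pair_ind_def split: if_splits)
      then show ?thesis using p0[OF False] w12 by (auto simp: E_def s_def)
    qed
    show "E a a = 0"
    proof -
      have "D1 a a = 0" "D2 a a = 0"
        using Nw[OF D1(1), of a a] Nw[OF D2N, of a a] w_irr[of a] by linarith+
      moreover have "pair_ind v1 v2 a a = 0" using \<open>v1 \<noteq> v2\<close> by (auto simp: pair_ind_def)
      ultimately show ?thesis by (simp add: E_def)
    qed
    show "E a b \<noteq> 0 \<longrightarrow> w a b = 1 \<or> a \<in> V - S \<and> b \<in> V - S"
    proof (intro impI)
      assume "E a b \<noteq> 0"
      then consider "D1 a b \<noteq> 0" | "D2 a b \<noteq> 0" | "pair_ind v1 v2 a b \<noteq> 0"
        by (force simp: E_def)
      then show "w a b = 1 \<or> a \<in> V - S \<and> b \<in> V - S"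
        using Nw[OF D1(1), of a b] Nw[OF D2N, of a b] D1(2) D2(2)
        by cases (auto simp: pair_ind_def split: if_splits)
    qed
  next
    show "\<forall>a\<in>V. (\<Sum>b\<in>V. E a b) = 0"
    proof
      fix a
      have "(\<Sum>b\<in>V. E a b) = 2 * s * (\<Sum>b\<in>V. pair_ind v1 v2 a b) - s * (\<Sum>b\<in>V. D1 a b) - s * (\<Sum>b\<in>V. D2 a b)"
        by (simp add: E_def sum_subtractf sum_distrib_left)
      then show "(\<Sum>b\<in>V. E a b) = 0"
        using sum_pair_ind[OF V, of v1 v2 a] D1(2,4) D2(2,4) \<open>v1 \<noteq> v2\<close> by (simp add: algebra_simps)
    qed
    have "w v1 b1 = 1" using Nw[OF D1(1) D1(3)] .
    moreover have "E v1 b1 \<noteq> 0"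
      using p0[of v1 b1] ex[of v1 b1] D1(3) s by (auto simp: E_def)
    ultimately show "\<exists>a b. w a b = 1 \<and> E a b \<noteq> 0" by blast
  qed
  then show False by (rule notE[OF contra exI])
qed

text \<open>Each improvement removes some ones and creates none. The pairs in \<open>T\<close> have
  entry 2 and lie inside \<open>S\<close>, so they are never changed; all other pairs inside
  \<open>S\<close> join different colours, which makes the ones there bipartite.\<close>

lemma half_integral_rounding:
  fixes w :: "'a \<Rightarrow> 'a \<Rightarrow> int" and d :: "'a \<Rightarrow> int"
  assumes V: "finite V" "S \<subseteq> V"
    and "\<And>a b. w a b = w b a" "\<And>a. w a a = 0"
    and "\<And>a b. w a b \<noteq> 0 \<Longrightarrow> a \<in> V \<and> b \<in> V"
    and "\<And>a b. w a b \<in> {0, 1, 2}"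
    and "\<And>a. a \<in> V \<Longrightarrow> (\<Sum>b\<in>V. w a b) = 2 * d a"
    and even: "even (\<Sum>a\<in>V. d a)"
    and "T \<subseteq> S \<times> S" "\<And>a b. (a, b) \<in> T \<Longrightarrow> w a b = 2"
    and col: "\<And>a b. a \<in> S \<Longrightarrow> b \<in> S \<Longrightarrow> a \<noteq> b \<Longrightarrow> (a, b) \<notin> T \<Longrightarrow> col a \<noteq> (col b :: bool)"
  shows "\<exists>w'. (\<forall>a b. w' a b = w' b a) \<and> (\<forall>a. w' a a = 0) \<and>
    (\<forall>a b. w' a b \<noteq> 0 \<longrightarrow> a \<in> V \<and> b \<in> V) \<and> (\<forall>a b. w' a b \<in> {0, 2}) \<and>
    (\<forall>a\<in>V. (\<Sum>b\<in>V. w' a b) = 2 * d a) \<and> (\<forall>(a, b)\<in>T. w' a b = 2)"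
  using assms(3-7,10)
proof (induction "card {(a, b). w a b = 1}" arbitrary: w rule: less_induct)
  case less
  show ?case
  proof (cases "{(a, b). w a b = 1} = {}")
    case True
    then have "\<forall>a b. w a b \<in> {0, 2}" using less.prems(4) by blast
    then show ?thesis
    proof (intro exI[of _ w] conjI ballI)
      show "\<forall>a b. w a b = w b a" "\<forall>a. w a a = 0" using less.prems(1,2) by auto
      show "\<forall>a b. w a b \<noteq> 0 \<longrightarrow> a \<in> V \<and> b \<in> V" using less.prems(3) by simp
    qed (use less.prems(5,6) in auto)
  next
    case False
    then obtain x y where xy: "(x, y) \<in> {(a, b). w a b = 1}" by auto
    have "col a \<noteq> col b" if "a \<in> S" "b \<in> S" "w a b = 1" for a b
      using that col less.prems(2)[of a] less.prems(6)[of a b] by fastforce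
    then obtain E where E: "\<forall>a b. E a b = E b a" "\<forall>a b. E a b = 0 \<or> w a b + E a b \<in> {0, 2}"
      "\<forall>a\<in>V. (\<Sum>b\<in>V. E a b) = 0" "\<forall>a. E a a = 0"
      "\<forall>a b. E a b \<noteq> 0 \<longrightarrow> w a b = 1 \<or> a \<in> V - S \<and> b \<in> V - S" "\<exists>a b. w a b = 1 \<and> E a b \<noteq> 0"
      using half_integral_improve[OF V(1) less.prems(1-5) even _ xy refl, of S col] by blast
    define w' where "w' = (\<lambda>a b. w a b + E a b)"
    have "{(a, b). w' a b = 1} \<subset> {(a, b). w a b = 1}"
    proof -
      have "w a b = 1 \<and> E a b = 0" if "w' a b = 1" for a b
        using E(2)[rule_format, of a b] that by (auto simp: w'_def)
      moreover obtain a b where "w a b = 1" "E a b \<noteq> 0" using E(6) by blast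
      ultimately show ?thesis by blast
    qed
    moreover have "finite {(a, b). w a b = 1}"
    proof (rule finite_subset)
      show "{(a, b). w a b = 1} \<subseteq> V \<times> V"
      proof clarify
        fix a b assume "w a b = 1"
        then show "a \<in> V \<and> b \<in> V" using less.prems(3)[of a b] by simp
      qed
    qed (use V in simp)
    ultimately have "card {(a, b). w' a b = 1} < card {(a, b). w a b = 1}"
      by (rule psubset_card_mono[rotated])
    moreover have "w' a b = w' b a" "w' a a = 0" for a b
      using less.prems(1)[of a b] E(1,4) less.prems(2) by (auto simp: w'_def)
    moreover have "a \<in> V \<and> b \<in> V" if "w' a b \<noteq> 0" for a b
    proof (cases "w a b = 0")
      case True
      then have "E a b \<noteq> 0" using that by (simp add: w'_def)
      then show ?thesis using E(5) True by force
    qed (use less.prems(3) in simp)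
    moreover have "w' a b \<in> {0, 1, 2}" for a b
      using less.prems(4)[of a b] E(2)[rule_format, of a b] by (auto simp: w'_def)
    moreover have "(\<Sum>b\<in>V. w' a b) = 2 * d a" if "a \<in> V" for a
      using less.prems(5)[OF that] E(3) that by (simp add: w'_def sum.distrib)
    moreover have "w' a b = 2" if "(a, b) \<in> T" for a b
      using less.prems(6)[OF that] that E(5)[rule_format, of a b] assms(9) by (auto simp: w'_def)
    ultimately show ?thesis using less.hyps[of w'] by blast
  qed
qed

section \<open>Realizations containing a prescribed graph\<close>

lemma sum_lessThan_shift: "(\<Sum>i<k. f (Suc i)) + f 0 = (\<Sum>i<k. f i) + (f k :: nat)"
  by (induction k) auto

text \<open>An alternating closed walk in the bipartite double cover, with rows \<open>u i\<close>
  and columns \<open>x i\<close>. Rows may repeat: as \<open>u\<close> closes up, each gains as many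
  entries as it loses. The columns are distinct, so each \<open>x i\<close> gains one entry and
  loses one.\<close>

lemma closed_path_switch:
  assumes fin: "finite B" and k: "u k = u 0" and inj: "inj_on x {..<k}"
    and add: "\<And>i. i < k \<Longrightarrow> (u i, x i) \<notin> B" and rem: "\<And>i. i < k \<Longrightarrow> (u (Suc i), x i) \<in> B"
  defines "A \<equiv> (\<lambda>i. (u i, x i)) ` {..<k}" and "R \<equiv> (\<lambda>i. (u (Suc i), x i)) ` {..<k}"
  shows "card (((B - R) \<union> A) `` {v}) = card (B `` {v})"
    and "card (((B - R) \<union> A)\<inverse> `` {v}) = card (B\<inverse> `` {v})"
proof -
  have finAR: "finite A" "finite R" by (auto simp: A_def R_def)
  have disj: "A \<inter> B = {}" "R \<subseteq> B" using add rem by (auto simp: A_def R_def)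
  have cA: "card (A `` {v}) = card {i. i < k \<and> u i = v}"
  proof -
    have "A `` {v} = x ` {i. i < k \<and> u i = v}" by (auto simp: A_def)
    then show ?thesis using inj by (simp add: card_image inj_on_def)
  qed
  have cR: "card (R `` {v}) = card {i. i < k \<and> u (Suc i) = v}"
  proof -
    have "R `` {v} = x ` {i. i < k \<and> u (Suc i) = v}" by (auto simp: R_def)
    then show ?thesis using inj by (simp add: card_image inj_on_def)
  qed
  have "card {i. i < k \<and> u (Suc i) = v} = card {i. i < k \<and> u i = v}"
  proof -
    have "card {i. i < k \<and> P i} = (\<Sum>i<k. of_bool (P i))" for P
      by (simp add: Int_def lessThan_def)
    then show ?thesis using sum_lessThan_shift[of "\<lambda>i. of_bool (u i = v)" k] k by simp
  qed
  then have c: "card (A `` {v}) = card (R `` {v})" using cA cR by simp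
  have "((B - R) \<union> A) `` {v} = (B `` {v} - R `` {v}) \<union> A `` {v}" by auto
  moreover have "(B `` {v} - R `` {v}) \<inter> A `` {v} = {}" using disj by auto
  moreover have "R `` {v} \<subseteq> B `` {v}" using disj by auto
  ultimately show "card (((B - R) \<union> A) `` {v}) = card (B `` {v})"
    using c fin finAR by (simp add: card_Un_disjoint card_Diff_subset finite_Image card_mono)
  have "A\<inverse> `` {v} = u ` {i. i < k \<and> x i = v}" "R\<inverse> `` {v} = (\<lambda>i. u (Suc i)) ` {i. i < k \<and> x i = v}"
    by (auto simp: A_def R_def)
  moreover have "inj_on h {i. i < k \<and> x i = v}" for h :: "nat \<Rightarrow> 'a"
    using inj by (auto simp: inj_on_def)
  ultimately have c: "card (A\<inverse> `` {v}) = card (R\<inverse> `` {v})"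
    by (simp add: card_image)
  have "((B - R) \<union> A)\<inverse> `` {v} = (B\<inverse> `` {v} - R\<inverse> `` {v}) \<union> A\<inverse> `` {v}" by auto
  moreover have "(B\<inverse> `` {v} - R\<inverse> `` {v}) \<inter> A\<inverse> `` {v} = {}" using disj by auto
  moreover have "R\<inverse> `` {v} \<subseteq> B\<inverse> `` {v}" using disj by auto
  ultimately show "card (((B - R) \<union> A)\<inverse> `` {v}) = card (B\<inverse> `` {v})"
    using c fin finAR by (simp add: card_Un_disjoint card_Diff_subset finite_Image card_mono)
qed

lemma card_eq_sum_rows:
  assumes "finite V" "C \<subseteq> V \<times> V" "X \<subseteq> V"
  shows "card (C \<inter> X \<times> Y) = (\<Sum>a\<in>X. card (C `` {a} \<inter> Y))"
proof -
  have "C \<inter> X \<times> Y = (SIGMA a:X. C `` {a} \<inter> Y)" by auto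
  moreover have "finite (C `` {a})" for a
    using assms finite_subset[of C] by (auto intro: finite_Image)
  ultimately show ?thesis
    using assms finite_subset[of X V] by (simp add: card_SigmaI)
qed

text \<open>Max-flow min-cut for the bipartite double cover: \<open>B\<close> is viewed as a 0/1 matrix, and a
  shortest augmenting path is found unless some pair \<open>(X, Y)\<close> is a violated cut.\<close>

lemma containing_matrix_exists:
  fixes T :: "('a \<times> 'a) set" and d :: "'a \<Rightarrow> nat"
  assumes V: "finite V" and T: "T \<subseteq> V \<times> V" "irrefl T"
    and B0: "B0 \<subseteq> V \<times> V" "irrefl B0" "\<And>a. a \<in> V \<Longrightarrow> card (B0 `` {a}) = d a" "\<And>a. a \<in> V \<Longrightarrow> card (B0\<inverse> `` {a}) = d a"
    and cut: "\<And>X Y. X \<subseteq> V \<Longrightarrow> Y \<subseteq> V \<Longrightarrow>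
       (\<Sum>a\<in>X. d a) + card (T \<inter> (V - X) \<times> Y) \<le> (\<Sum>a\<in>Y. d a) + card (X \<times> (V - Y) - Id)"
  shows "\<exists>B. T \<subseteq> B \<and> B \<subseteq> V \<times> V \<and> irrefl B \<and> (\<forall>a\<in>V. card (B `` {a}) = d a) \<and> (\<forall>a\<in>V. card (B\<inverse> `` {a}) = d a)"
  using B0
proof (induction "card (T - B0)" arbitrary: B0 rule: less_induct)
  case (less B)
  show ?case
  proof (cases "T \<subseteq> B")
    case True
    then show ?thesis using less.prems by blast
  next
    case False
    then obtain y x0 where yx: "(y, x0) \<in> T" "(y, x0) \<notin> B" by auto
    have yV: "y \<in> V" "x0 \<in> V" "y \<noteq> x0" using yx T by (auto simp: irrefl_def)
    have finB: "finite B" using less.prems(1) V finite_subset by blast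
    have finT: "finite T" using T(1) V finite_subset by blast
    \<comment> \<open>A step from column \<open>x\<close> to column \<open>x'\<close> moves an entry
      within some row \<open>u\<close>, leaving the entries in \<open>T\<close> and the empty
      diagonal alone.\<close>
    define step where "step = {(x, x'). x' \<in> V \<and> (\<exists>u. (u, x) \<in> B - T \<and> (u, x') \<notin> B \<and> u \<noteq> x')}"
    define K where "K = {x. (x0, x) \<in> step\<^sup>*}"
    define R where "R = {u. \<exists>x\<in>K. (u, x) \<in> B - T}"
    have KV: "K \<subseteq> V"
    proof
      fix x assume "x \<in> K"
      then have "(x0, x) \<in> step\<^sup>*" by (simp add: K_def)
      then show "x \<in> V" by (induction rule: rtrancl_induct) (use yV in \<open>auto simp: step_def\<close>)
    qed
    have RV: "R \<subseteq> V" using less.prems(1) by (auto simp: R_def)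
    have "y \<in> R"
    proof (rule ccontr)
      \<comment> \<open>Then the rows in \<open>R\<close> are full outside the columns
        \<open>K\<close>, and in these columns the other rows have only entries from
        \<open>T\<close>, lacking \<open>(y, x0)\<close>. Counting entries shows that
        \<open>(R, K)\<close> violates the cut condition.\<close>
      assume yR: "y \<notin> R"
      have closed: "(u, x) \<in> B" if "u \<in> R" "x \<in> V - K" "u \<noteq> x" for u x
      proof (rule ccontr)
        assume "(u, x) \<notin> B"
        obtain x' where "x' \<in> K" "(u, x') \<in> B - T" using \<open>u \<in> R\<close> by (auto simp: R_def)
        moreover from this(2) have "(x', x) \<in> step"
          using that \<open>(u, x) \<notin> B\<close> by (auto simp: step_def)
        ultimately have "x \<in> K" by (auto simp: K_def)
        then show False using that by simp
      qed
      have sub1: "R \<times> (V - K) - Id \<subseteq> B \<inter> R \<times> (V - K)" using closed by auto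
      have sub2: "B \<inter> (V - R) \<times> K \<subset> T \<inter> (V - R) \<times> K"
      proof -
        have "B \<inter> (V - R) \<times> K \<subseteq> T" by (auto simp: R_def)
        moreover have "(y, x0) \<in> T \<inter> (V - R) \<times> K" using yx yV yR by (auto simp: K_def)
        ultimately show ?thesis using yx(2) by blast
      qed
      have rowR: "(\<Sum>a\<in>R. d a) = card (B \<inter> R \<times> V)"
      proof -
        have "card (B `` {a} \<inter> V) = d a" if "a \<in> R" for a
        proof -
          have "B `` {a} \<inter> V = B `` {a}" using less.prems(1) by auto
          then show ?thesis using less.prems(3) RV that by auto
        qed
        then show ?thesis using card_eq_sum_rows[OF V less.prems(1) RV, of V] by simp
      qed
      have colK: "(\<Sum>a\<in>K. d a) = card (B \<inter> V \<times> K)"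
      proof -
        have "card (B\<inverse> `` {a} \<inter> V) = d a" if "a \<in> K" for a
        proof -
          have "B\<inverse> `` {a} \<inter> V = B\<inverse> `` {a}" using less.prems(1) by auto
          then show ?thesis using less.prems(4) KV that by auto
        qed
        moreover have "B\<inverse> \<subseteq> V \<times> V" using less.prems(1) by auto
        ultimately have "(\<Sum>a\<in>K. d a) = card (B\<inverse> \<inter> K \<times> V)"
          using card_eq_sum_rows[OF V _ KV, of "B\<inverse>" V] by simp
        also have "B\<inverse> \<inter> K \<times> V = (B \<inter> V \<times> K)\<inverse>" by auto
        finally show ?thesis by simp
      qed
      have "B \<inter> R \<times> V = (B \<inter> R \<times> (V - K)) \<union> (B \<inter> R \<times> K)" using KV by auto
      then have e1: "card (B \<inter> R \<times> V) = card (B \<inter> R \<times> (V - K)) + card (B \<inter> R \<times> K)"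
        using finB by (auto intro!: card_Un_disjoint)
      have "B \<inter> V \<times> K = (B \<inter> R \<times> K) \<union> (B \<inter> (V - R) \<times> K)" using RV by auto
      then have e2: "card (B \<inter> V \<times> K) = card (B \<inter> R \<times> K) + card (B \<inter> (V - R) \<times> K)"
        using finB by (auto intro!: card_Un_disjoint)
      have "card (R \<times> (V - K) - Id) \<le> card (B \<inter> R \<times> (V - K))"
        using sub1 finB by (auto intro: card_mono)
      moreover have "card (B \<inter> (V - R) \<times> K) < card (T \<inter> (V - R) \<times> K)"
        using sub2 finT by (auto intro: psubset_card_mono)
      ultimately show False using cut[OF RV KV] rowR colK e1 e2 by linarith
    qed
    then obtain xe where "(x0, xe) \<in> step\<^sup>*" "(y, xe) \<in> B - T" by (auto simp: R_def K_def)
    then have "\<exists>m xe. (x0, xe) \<in> step ^^ m \<and> (y, xe) \<in> B - T"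
      by (auto simp: rtrancl_power)
    \<comment> \<open>A shortest path repeats no column, as \<open>closed_path_switch\<close>
      demands.\<close>
    define m where "m = (LEAST m. \<exists>xe. (x0, xe) \<in> step ^^ m \<and> (y, xe) \<in> B - T)"
    obtain xm where xm: "(x0, xm) \<in> step ^^ m" "(y, xm) \<in> B - T"
      using LeastI_ex[OF \<open>\<exists>m xe. _ m xe\<close>] unfolding m_def by blast
    have mmin: "m \<le> m'" if "(x0, xe) \<in> step ^^ m'" "(y, xe) \<in> B - T" for m' xe
      unfolding m_def by (rule Least_le) (use that in blast)
    obtain x where x: "x 0 = x0" "x m = xm" "\<And>i. i < m \<Longrightarrow> (x i, x (Suc i)) \<in> step"
      using xm(1) by (auto simp: relpow_fun_conv)
    have reach: "(x i, x (i + l)) \<in> step ^^ l" if "i + l \<le> m" for i l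
      using that x(3) by (induction l) (auto intro: relcompI)
    have injx: "inj_on x {..<Suc m}"
    proof (rule ccontr)
      assume "\<not> ?thesis"
      then obtain i j where ij: "i < j" "j \<le> m" "x i = x j"
        by (auto simp: inj_on_def) (metis less_Suc_eq_le nat_neq_iff)
      have "(x 0, x i) \<in> step ^^ i" using reach[of 0 i] ij by simp
      moreover have "(x j, x m) \<in> step ^^ (m - j)" using reach[of j "m - j"] ij by simp
      ultimately have "(x 0, x m) \<in> step ^^ (i + (m - j))"
        unfolding relpow_add using ij(3) by (metis relcompI)
      then have "(x0, xm) \<in> step ^^ (i + (m - j))" using x(1,2) by simp
      then show False using mmin[OF _ xm(2)] ij by fastforce
    qed
    have "\<exists>u. (u, x i) \<in> B - T \<and> (u, x (Suc i)) \<notin> B \<and> u \<noteq> x (Suc i)" if "i < m" for i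
      using x(3)[OF that] by (auto simp: step_def)
    then obtain u' where u': "\<And>i. i < m \<Longrightarrow> (u' i, x i) \<in> B - T \<and> (u' i, x (Suc i)) \<notin> B \<and> u' i \<noteq> x (Suc i)"
      by metis
    \<comment> \<open>For \<open>i < m\<close>, row \<open>u (Suc i)\<close> gives up column
      \<open>x i\<close> and takes \<open>x (Suc i)\<close>. Row \<open>y\<close> takes
      \<open>x0\<close> at the start and gives up \<open>xm\<close> at the end, which closes the
      cycle.\<close>
    define u where "u = (\<lambda>i. if i = 0 \<or> i > m then y else u' (i - 1))"
    have xV: "x i \<in> V" if "i \<le> m" for i
      using that x(1) yV(2) x(3)[of "i - 1"] by (cases i) (auto simp: step_def)
    have add: "(u i, x i) \<notin> B \<and> u i \<noteq> x i \<and> u i \<in> V" if "i < Suc m" for i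
    proof (cases i)
      case 0 then show ?thesis using yx yV x by (simp add: u_def)
    next
      case (Suc j)
      then have "(u' j, x j) \<in> B" using u'[of j] that by auto
      then show ?thesis using u'[of j] that Suc less.prems(1) by (auto simp: u_def)
    qed
    have rem: "(u (Suc i), x i) \<in> B - T" if "i < Suc m" for i
      using that u'[of i] xm(2) x(2) by (cases "i = m") (auto simp: u_def)
    have uk: "u (Suc m) = u 0" by (simp add: u_def)
    define Ad where "Ad = (\<lambda>i. (u i, x i)) ` {..<Suc m}"
    define Re where "Re = (\<lambda>i. (u (Suc i), x i)) ` {..<Suc m}"
    define B' where "B' = (B - Re) \<union> Ad"
    have "card (B' `` {a}) = d a" "card (B'\<inverse> `` {a}) = d a" if "a \<in> V" for a
      using closed_path_switch[OF finB uk injx, of a] add rem less.prems(3,4)[OF that]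
      by (auto simp: B'_def Ad_def Re_def)
    moreover have "B' \<subseteq> V \<times> V"
      using less.prems(1) add xV by (force simp: B'_def Ad_def)
    moreover have "irrefl B'"
      using less.prems(2) add by (force simp: B'_def Ad_def irrefl_def)
    moreover have "card (T - B') < card (T - B)"
    proof (rule psubset_card_mono)
      show "finite (T - B)" using finT by simp
      have "T - B' \<subseteq> T - B" using rem by (auto simp: B'_def Re_def)
      moreover have "(y, x0) \<in> B'"
        using x(1) by (auto simp: B'_def Ad_def u_def intro!: image_eqI[of _ _ 0])
      ultimately show "T - B' \<subset> T - B" using yx by blast
    qed
    ultimately show ?thesis using less.hyps[of B'] by blast
  qed
qed

lemma card_square_Diff_Id:
  assumes "finite X" "finite Y"
  shows "card (X \<times> Y - Id) = card X * card Y - card (X \<inter> Y)"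
proof -
  have "X \<times> Y - Id = X \<times> Y - (\<lambda>a. (a, a)) ` (X \<inter> Y)" by auto
  moreover have "card ((\<lambda>a. (a, a)) ` (X \<inter> Y)) = card (X \<inter> Y)"
    by (simp add: card_image inj_on_def)
  moreover have "(\<lambda>a. (a, a)) ` (X \<inter> Y) \<subseteq> X \<times> Y" by auto
  ultimately show ?thesis using assms by (simp add: card_Diff_subset card_cartesian_product)
qed

lemma card_product_Diff_Id:
  assumes "finite V" "X \<subseteq> V" "Y \<subseteq> V" "X \<inter> Y = {}"
  shows "card (X \<times> (V - Y) - Id) = card X * (card V - 1 - card Y)"
proof (cases "X = {}")
  case False
  have "finite X" using assms(1,2) finite_subset by blast
  have "finite Y" using assms(1,3) finite_subset by blast
  have "X \<inter> (V - Y) = X" using assms by auto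
  then have "card (X \<times> (V - Y) - Id) = card X * card (V - Y) - card X"
    using assms \<open>finite X\<close> by (simp add: card_square_Diff_Id)
  also have "\<dots> = card X * (card (V - Y) - 1)" by (simp add: diff_mult_distrib2)
  also have "card (V - Y) = card V - card Y" using assms \<open>finite Y\<close> by (simp add: card_Diff_subset)
  finally show ?thesis by simp
qed simp

text \<open>A violated cut \<open>(X, Y)\<close> may be replaced by the disjoint cut \<open>(X - Y, Y - X)\<close>.\<close>

lemma disjoint_cuts_suffice:
  fixes T :: "('a \<times> 'a) set" and d :: "'a \<Rightarrow> nat"
  assumes V: "finite V" and T: "T \<subseteq> V \<times> V" "irrefl T" "sym T"
    and cut: "\<And>P Q. P \<subseteq> V \<Longrightarrow> Q \<subseteq> V \<Longrightarrow> P \<inter> Q = {} \<Longrightarrow>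
       (\<Sum>a\<in>P. d a) + card (T \<inter> (V - P) \<times> Q) \<le> (\<Sum>a\<in>Q. d a) + card (P \<times> (V - Q) - Id)"
    and XY: "X \<subseteq> V" "Y \<subseteq> V"
  shows "(\<Sum>a\<in>X. d a) + card (T \<inter> (V - X) \<times> Y) \<le> (\<Sum>a\<in>Y. d a) + card (X \<times> (V - Y) - Id)"
proof -
  define I where "I = X \<inter> Y"
  define N where "N = V - (X \<union> Y)"
  have fin: "finite X" "finite Y" "finite I" "finite N" "finite T"
    using V XY T(1) finite_subset[of _ V] finite_subset[of T "V \<times> V"] by (auto simp: I_def N_def)
  have sX: "(\<Sum>a\<in>X. d a) = (\<Sum>a\<in>X - Y. d a) + (\<Sum>a\<in>I. d a)"
    unfolding I_def using fin by (metis add.commute sum.Int_Diff)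
  have sY: "(\<Sum>a\<in>Y. d a) = (\<Sum>a\<in>Y - X. d a) + (\<Sum>a\<in>I. d a)"
    unfolding I_def using fin by (metis Int_commute add.commute sum.Int_Diff)
  \<comment> \<open>The sums over \<open>I\<close> cancel. By symmetry, the pairs of
    \<open>T\<close> from \<open>Y - X\<close> into \<open>I\<close> become pairs from
    \<open>I\<close> into \<open>Y - X\<close>. Those from \<open>N\<close> into \<open>I\<close>
    are lost, but so are all pairs of \<open>I \<times> N\<close> on the right-hand side.\<close>
  have "T \<inter> (V - X) \<times> Y = (T \<inter> (V - X) \<times> (Y - X)) \<union> (T \<inter> (Y - X) \<times> I) \<union> (T \<inter> N \<times> I)"
    using XY by (auto simp: I_def N_def)
  then have "card (T \<inter> (V - X) \<times> Y) \<le> card (T \<inter> (V - X) \<times> (Y - X)) + card (T \<inter> (Y - X) \<times> I) + card (T \<inter> N \<times> I)"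
    by (metis (no_types, lifting) add_le_mono1 card_Un_le le_trans)
  moreover have "card (T \<inter> N \<times> I) \<le> card (N \<times> I)"
    using fin by (intro card_mono) auto
  moreover have "card (T \<inter> (V - X) \<times> (Y - X)) + card (T \<inter> (Y - X) \<times> I) = card (T \<inter> (V - (X - Y)) \<times> (Y - X))"
  proof -
    have "T \<inter> (Y - X) \<times> I = (T \<inter> I \<times> (Y - X))\<inverse>" using T(3) by (auto dest: symD)
    then have "card (T \<inter> (Y - X) \<times> I) = card (T \<inter> I \<times> (Y - X))" by simp
    moreover have "T \<inter> (V - (X - Y)) \<times> (Y - X) = (T \<inter> (V - X) \<times> (Y - X)) \<union> (T \<inter> I \<times> (Y - X))"
      using XY by (auto simp: I_def)
    moreover have "card ((T \<inter> (V - X) \<times> (Y - X)) \<union> (T \<inter> I \<times> (Y - X))) = card (T \<inter> (V - X) \<times> (Y - X)) + card (T \<inter> I \<times> (Y - X))"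
      using fin by (intro card_Un_disjoint) (auto simp: I_def)
    ultimately show ?thesis by simp
  qed
  moreover have "card ((X - Y) \<times> (V - (Y - X)) - Id) + card (N \<times> I) = card (X \<times> (V - Y) - Id)"
  proof -
    have "(X - Y) \<times> (V - (Y - X)) - Id = ((X - Y) \<times> (V - Y) - Id) \<union> ((X - Y) \<times> I)"
      using XY by (auto simp: I_def)
    moreover have "card (((X - Y) \<times> (V - Y) - Id) \<union> ((X - Y) \<times> I)) = card ((X - Y) \<times> (V - Y) - Id) + card ((X - Y) \<times> I)"
      using fin V by (intro card_Un_disjoint) (auto simp: I_def)
    moreover have "X \<times> (V - Y) - Id = ((X - Y) \<times> (V - Y) - Id) \<union> (I \<times> (X - Y) \<union> I \<times> N)"
      using XY by (auto simp: I_def N_def)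
    moreover have "card (((X - Y) \<times> (V - Y) - Id) \<union> (I \<times> (X - Y) \<union> I \<times> N)) = card ((X - Y) \<times> (V - Y) - Id) + card (I \<times> (X - Y) \<union> I \<times> N)"
      using fin V by (intro card_Un_disjoint) (auto simp: I_def N_def)
    moreover have "card (I \<times> (X - Y) \<union> I \<times> N) = card (I \<times> (X - Y)) + card (I \<times> N)"
      using fin by (intro card_Un_disjoint) (auto simp: I_def N_def)
    ultimately show ?thesis by (simp add: card_cartesian_product mult.commute)
  qed
  moreover have "(\<Sum>a\<in>X - Y. d a) + card (T \<inter> (V - (X - Y)) \<times> (Y - X)) \<le> (\<Sum>a\<in>Y - X. d a) + card ((X - Y) \<times> (V - (Y - X)) - Id)"
    using XY by (intro cut) auto
  ultimately show ?thesis using sX sY by linarith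
qed

text \<open>A special case of the Fulkerson--Hoffman--McAndrew theorem on \<open>f\<close>-factors: the complement
  of \<open>T\<close> satisfies the odd cycle condition because it is bipartite on \<open>S\<close> and all vertices outside
  \<open>S\<close> are universal in it.\<close>

theorem realization_containing:
  fixes T G :: "('a \<times> 'a) set" and d :: "'a \<Rightarrow> nat"
  assumes V: "finite V" "S \<subseteq> V" and T: "T \<subseteq> S \<times> S" "irrefl T" "sym T"
    and G: "G \<subseteq> V \<times> V" "irrefl G" "sym G" "\<And>a. a \<in> V \<Longrightarrow> card (G `` {a}) = d a"
    and even: "even (\<Sum>a\<in>V. d a)"
    and col: "\<And>a b. a \<in> S \<Longrightarrow> b \<in> S \<Longrightarrow> a \<noteq> b \<Longrightarrow> (a, b) \<notin> T \<Longrightarrow> col a \<noteq> (col b :: bool)"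
    and cut: "\<And>P Q. P \<subseteq> V \<Longrightarrow> Q \<subseteq> V \<Longrightarrow> P \<inter> Q = {} \<Longrightarrow>
       (\<Sum>a\<in>P. d a) + card (T \<inter> (V - P) \<times> Q) \<le> (\<Sum>a\<in>Q. d a) + card P * (card V - 1 - card Q)"
  shows "\<exists>G'. T \<subseteq> G' \<and> G' \<subseteq> V \<times> V \<and> irrefl G' \<and> sym G' \<and> (\<forall>a\<in>V. card (G' `` {a}) = d a)"
proof -
  have TV: "T \<subseteq> V \<times> V" using T(1) V(2) by auto
  have "\<exists>B. T \<subseteq> B \<and> B \<subseteq> V \<times> V \<and> irrefl B \<and> (\<forall>a\<in>V. card (B `` {a}) = d a) \<and> (\<forall>a\<in>V. card (B\<inverse> `` {a}) = d a)"
  proof (rule containing_matrix_exists[OF V(1) TV T(2) G(1,2,4)])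
    show "card (G\<inverse> `` {a}) = d a" if "a \<in> V" for a
      using G(3,4) that by (simp add: sym_conv_converse_eq)
    show "(\<Sum>a\<in>X. d a) + card (T \<inter> (V - X) \<times> Y) \<le> (\<Sum>a\<in>Y. d a) + card (X \<times> (V - Y) - Id)"
      if "X \<subseteq> V" "Y \<subseteq> V" for X Y
      using disjoint_cuts_suffice[OF V(1) TV T(2,3) _ that, of d] cut card_product_Diff_Id[OF V(1)] by simp
  qed
  then obtain B where B: "T \<subseteq> B" "B \<subseteq> V \<times> V" "irrefl B" "\<forall>a\<in>V. card (B `` {a}) = d a" "\<forall>a\<in>V. card (B\<inverse> `` {a}) = d a"
    by blast
  \<comment> \<open>Directions are forgotten by adding the transpose of \<open>B\<close>: this is
    twice a half-integral factor, with entry 2 on the symmetric relation \<open>T\<close>.\<close>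
  define w :: "'a \<Rightarrow> 'a \<Rightarrow> int" where "w = (\<lambda>a b. of_bool ((a, b) \<in> B) + of_bool ((b, a) \<in> B))"
  have rows: "(\<Sum>b\<in>V. of_bool ((a, b) \<in> C)) = int (card (C `` {a}))" if "C \<subseteq> V \<times> V" for C :: "('a \<times> 'a) set" and a
  proof -
    have "V \<inter> {b. (a, b) \<in> C} = C `` {a}" using that by auto
    then show ?thesis using V(1) by simp
  qed
  have wsum: "(\<Sum>b\<in>V. w a b) = 2 * int (d a)" if "a \<in> V" for a
  proof -
    have "(\<Sum>b\<in>V. of_bool ((b, a) \<in> B)) = int (card (B\<inverse> `` {a}))"
      using rows[of "B\<inverse>" a] B(2) by auto
    then show ?thesis using rows[OF B(2), of a] B(4,5) that by (simp add: w_def sum.distrib)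
  qed
  have "\<exists>w'. (\<forall>a b. w' a b = w' b a) \<and> (\<forall>a. w' a a = 0) \<and>
    (\<forall>a b. w' a b \<noteq> 0 \<longrightarrow> a \<in> V \<and> b \<in> V) \<and> (\<forall>a b. w' a b \<in> {0, 2}) \<and>
    (\<forall>a\<in>V. (\<Sum>b\<in>V. w' a b) = 2 * int (d a)) \<and> (\<forall>(a, b)\<in>T. w' a b = 2)"
  proof (rule half_integral_rounding[OF V _ _ _ _ wsum _ T(1)])
    show "even (\<Sum>a\<in>V. int (d a))" using even by (metis even_of_nat of_nat_sum)
    show "w a b = 2" if "(a, b) \<in> T" for a b
      using that B(1) T(3) by (auto simp: w_def dest: symD)
    show "a \<in> V \<and> b \<in> V" if "w a b \<noteq> 0" for a b
      using that B(2) by (auto simp: w_def of_bool_def split: if_splits)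
    show "col a \<noteq> col b" if "a \<in> S" "b \<in> S" "a \<noteq> b" "(a, b) \<notin> T" for a b
      using col that .
  qed (use B(3) in \<open>auto simp: w_def irrefl_def\<close>)
  then obtain w' :: "'a \<Rightarrow> 'a \<Rightarrow> int" where w': "\<forall>a b. w' a b = w' b a" "\<forall>a. w' a a = 0"
    "\<forall>a b. w' a b \<noteq> 0 \<longrightarrow> a \<in> V \<and> b \<in> V" "\<forall>a b. w' a b \<in> {0, 2}"
    "\<forall>a\<in>V. (\<Sum>b\<in>V. w' a b) = 2 * int (d a)" "\<forall>(a, b)\<in>T. w' a b = 2"
    by blast
  define G' where "G' = {(a, b). w' a b = 2}"
  have sub: "G' \<subseteq> V \<times> V"
  proof
    fix e assume "e \<in> G'"
    then obtain a b where "e = (a, b)" "w' a b = 2" by (auto simp: G'_def)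
    then show "e \<in> V \<times> V" using w'(3)[rule_format, of a b] by simp
  qed
  have "card (G' `` {a}) = d a" if "a \<in> V" for a
  proof -
    have "w' a b = 2 * of_bool ((a, b) \<in> G')" for b using w'(4)[rule_format, of a b] by (auto simp: G'_def)
    then have "(\<Sum>b\<in>V. w' a b) = 2 * (\<Sum>b\<in>V. of_bool ((a, b) \<in> G'))" by (simp add: sum_distrib_left)
    then show ?thesis using rows[OF sub, of a] w'(5) that by simp
  qed
  moreover have "T \<subseteq> G'" "irrefl G'" "sym G'"
    using w'(1,2,6) by (auto simp: G'_def irrefl_def sym_def)
  ultimately show ?thesis using sub by blast
qed

section \<open>The cut condition for dense degree sequences\<close>

text \<open>Here \<open>j\<close> will be the number of core vertices outside \<open>P\<close>; with
  \<open>f0_estimate\<close> the inequality gives \<open>w * (j - w) \<le> f0\<close>. The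
  subtracted side is largest at \<open>w = j - 1\<close>, and \<open>s\<close> is the distance from
  there.\<close>

lemma estimate_arith_weak:
  fixes j w p n :: int
  assumes "4 \<le> j" "j \<le> p + 3" "2 \<le> p" "4 * p + 18 \<le> n" "0 \<le> w" "w \<le> j - 1"
  shows "2 * (j - 3) * (n - p) + (j - 3) * (j - 4) + 2 \<ge> (j + w) * (j + w - 1) + 2 * w * (j - w)"
proof -
  define s where "s = j - 1 - w"
  have s: "s \<ge> 0" "w = j - 1 - s" using assms by (auto simp: s_def)
  have "(j + w) * (j + w - 1) + 2 * w * (j - w) = 4 * j * j - 4 * j - s * (2 * j + 1) - s * s"
    unfolding s(2) by (simp add: algebra_simps)
  also have "\<dots> \<le> 4 * j * j - 4 * j"
  proof -
    have "0 \<le> s * (2 * j + 1)" "0 \<le> s * s" using s(1) assms(1) by simp_all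
    then show ?thesis by linarith
  qed
  also have "\<dots> \<le> 2 * (j - 3) * (n - p) + (j - 3) * (j - 4) + 2"
  \<comment> \<open>The bound \<open>3 * j + 9\<close> for \<open>n - p\<close> is enough once
    \<open>j\<close> is at least 5. For \<open>j = 4\<close> it gives only 21, while
    \<open>2 \<le> p\<close> gives 24.\<close>
  proof (cases "j = 4")
    case False
    define Z where "Z = 2 * (j - 3) * (n - p)"
    define J where "J = j * j"
    have "2 * (j - 3) * (3 * j + 9) \<le> Z"
      unfolding Z_def using assms by (intro mult_left_mono) auto
    then have "6 * J - 54 \<le> Z" by (simp add: J_def algebra_simps)
    moreover have "5 * j \<le> J" unfolding J_def using False assms(1) by (intro mult_right_mono) auto
    moreover have "2 * (j - 3) * (n - p) + (j - 3) * (j - 4) + 2 = Z + J - 7 * j + 14"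
      by (simp add: J_def Z_def algebra_simps)
    moreover have "4 * j * j = 4 * J" by (simp add: J_def)
    ultimately show ?thesis using False assms(1) by linarith
  qed (use assms in auto)
  finally show ?thesis .
qed

text \<open>The variant for a vertex \<open>p + 2\<close> of low degree: with
  \<open>f0_estimate\<close> it gives \<open>2 + w * (j - 1 - w) \<le> f0\<close>, where the 2
  covers the deficit \<beta> of \<open>slack_bound_low\<close>.\<close>

lemma estimate_arith_strong:
  fixes j w p n :: int
  assumes "4 \<le> j" "j \<le> p + 3" "2 \<le> p" "4 * p + 18 \<le> n" "0 \<le> w" "w \<le> j - 2"
  shows "2 * (j - 3) * (n - p) + (j - 3) * (j - 4) + 2 \<ge> (j + w) * (j + w - 1) + 2 * (2 + w * (j - 1 - w))"
proof -
  define s where "s = j - 2 - w"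
  have s: "s \<ge> 0" "w = j - 2 - s" using assms by (auto simp: s_def)
  have "(j + w) * (j + w - 1) + 2 * (2 + w * (j - 1 - w)) = 4 * j * j - 8 * j + 6 - s * (2 * j + 1) - s * s"
    unfolding s(2) by (simp add: algebra_simps)
  also have "\<dots> \<le> 4 * j * j - 8 * j + 6"
  proof -
    have "0 \<le> s * (2 * j + 1)" "0 \<le> s * s" using s(1) assms(1) by simp_all
    then show ?thesis by linarith
  qed
  also have "\<dots> \<le> 2 * (j - 3) * (n - p) + (j - 3) * (j - 4) + 2"
  proof (cases "j = 4")
    case False
    define Z where "Z = 2 * (j - 3) * (n - p)"
    define J where "J = j * j"
    have "2 * (j - 3) * (3 * j + 9) \<le> Z"
      unfolding Z_def using assms by (intro mult_left_mono) auto
    then have "6 * J - 54 \<le> Z" by (simp add: J_def algebra_simps)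
    moreover have "5 * j \<le> J" unfolding J_def using False assms(1) by (intro mult_right_mono) auto
    moreover have "2 * (j - 3) * (n - p) + (j - 3) * (j - 4) + 2 = Z + J - 7 * j + 14"
      by (simp add: J_def Z_def algebra_simps)
    moreover have "4 * j * j = 4 * J" by (simp add: J_def)
    ultimately show ?thesis using False assms(1) by linarith
  qed (use assms in auto)
  finally show ?thesis .
qed

lemma sum_estimate_arith:
  fixes k u f n :: int
  assumes "sU \<le> f + u * (k + u - 1)" "f = k * (k + u - 1) + sQ - sX" "sX \<le> k * (n - 1)"
  shows "sX + sQ + sU \<le> 2 * k * (n - 1) - k * (k - 1) + u * (u - 1) + 2 * f"
proof -
  have "u * (k + u - 1) - k * (k + u - 1) = u * (u - 1) - k * (k - 1)" by (simp add: algebra_simps)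
  moreover have "2 * k * (n - 1) = 2 * (k * (n - 1))" by simp
  ultimately show ?thesis using assms by presburger
qed

text \<open>The adjacency relation of \<open>K\<^bsub>p+3\<^esub> - P\<^sub>2\<close>, the vertex \<open>p + 2\<close> being the middle of the path.\<close>

definition core_rel :: "nat \<Rightarrow> (nat \<times> nat) set" where
  "core_rel p = {(u, v). u < p + 3 \<and> v < p + 3 \<and> u \<noteq> v \<and>
     \<not> (u = p + 2 \<and> v \<in> {p, p + 1}) \<and> \<not> (v = p + 2 \<and> u \<in> {p, p + 1})}"

text \<open>What is kept of a graphic sequence is the parity of its sum and the Erdos-Gallai
  inequality for all disjoint pairs of sets. Degrees are integers so that differences are not
  truncated.\<close>

locale dense_degrees =
  fixes n p :: nat and d :: "nat \<Rightarrow> int"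
  assumes p2: "2 \<le> p" and n_ge: "4 * p + 18 \<le> n"
    and cut_nonneg: "\<And>P Q. P \<subseteq> {..<n} \<Longrightarrow> Q \<subseteq> {..<n} \<Longrightarrow> P \<inter> Q = {} \<Longrightarrow>
      sum d P \<le> int (card P) * (int n - 1 - int (card Q)) + sum d Q"
    and antimono: "\<And>i j. i \<le> j \<Longrightarrow> j < n \<Longrightarrow> d j \<le> d i"
    and even_sum: "even (\<Sum>i<n. d i)"
    and sum_ge: "int p * (2 * int n - int p - 1) + 2 \<le> (\<Sum>i<n. d i)"
begin

text \<open>In a realization this counts the nonadjacent pairs of distinct vertices from
  \<open>P\<close> to the outside of \<open>Q\<close>, plus the adjacent pairs from \<open>Q\<close>
  to the outside of \<open>P\<close>.\<close>

definition slack :: "nat set \<Rightarrow> nat set \<Rightarrow> int" where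
  "slack P Q = int (card P) * (int n - 1 - int (card Q)) + sum d Q - sum d P"

lemma slack_nonneg: "P \<subseteq> {..<n} \<Longrightarrow> Q \<subseteq> {..<n} \<Longrightarrow> P \<inter> Q = {} \<Longrightarrow> 0 \<le> slack P Q"
  using cut_nonneg[of P Q] by (simp add: slack_def)

lemma slack_Un_left:
  assumes "finite P1" "finite P2" "P1 \<inter> P2 = {}"
  shows "slack (P1 \<union> P2) Q = slack P1 Q + (\<Sum>u\<in>P2. int n - 1 - int (card Q) - d u)"
  using assms by (simp add: slack_def sum.union_disjoint card_Un_disjoint sum_subtractf sum.distrib algebra_simps)

lemma slack_Un_right:
  assumes "finite Q1" "finite Q2" "Q1 \<inter> Q2 = {}"
  shows "slack P (Q1 \<union> Q2) = slack P Q1 + (\<Sum>u\<in>Q2. d u - int (card P))"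
  using assms by (simp add: slack_def sum.union_disjoint card_Un_disjoint sum_subtractf sum.distrib algebra_simps)

lemma d_le: "i < n \<Longrightarrow> d i \<le> int n - 1"
  using cut_nonneg[of "{i}" "{}"] by simp

text \<open>Used to see that a large degree sum forces a large slack. With \<open>U\<close> the set
  of remaining vertices, nonnegative slack of \<open>(X \<union> U, Q)\<close> bounds the sum over
  \<open>U\<close>; the slack of \<open>(X, Q)\<close> determines the sum over \<open>Q\<close> from
  that over \<open>X\<close>, where degrees are at most \<open>n - 1\<close>.\<close>

lemma sum_estimate:
  assumes "X \<subseteq> {..<n}" "Q \<subseteq> {..<n}" "X \<inter> Q = {}"
  defines "k \<equiv> int (card X)" and "u \<equiv> int n - int (card Q) - int (card X)"
  shows "(\<Sum>i<n. d i) \<le> 2 * k * (int n - 1) - k * (k - 1) + u * (u - 1) + 2 * slack X Q"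
proof -
  define U where "U = {..<n} - X - Q"
  have fin: "finite X" "finite Q" "finite U" using assms finite_subset[of _ "{..<n}"] by (auto simp: U_def)
  have V: "{..<n} = X \<union> Q \<union> U" "X \<inter> U = {}" "Q \<inter> U = {}" using assms by (auto simp: U_def)
  have "card {..<n} = card X + card Q + card U"
    unfolding V(1) using fin V assms(3) by (simp add: card_Un_disjoint Int_Un_distrib2)
  then have cU: "int (card U) = u" by (simp add: u_def)
  have tot: "(\<Sum>i<n. d i) = sum d X + sum d Q + sum d U"
    unfolding V(1) using fin V assms(3) by (simp add: sum.union_disjoint Int_Un_distrib2)
  have nQ: "int n - 1 - int (card Q) = k + u - 1" by (simp add: k_def u_def)
  have "0 \<le> slack (X \<union> U) Q"
    using assms by (intro slack_nonneg) (auto simp: U_def)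
  also have "\<dots> = slack X Q + u * (k + u - 1) - sum d U"
    using fin V cU nQ by (simp add: slack_Un_left sum_subtractf)
  finally have 1: "sum d U \<le> slack X Q + u * (k + u - 1)" by simp
  have 2: "slack X Q = k * (k + u - 1) + sum d Q - sum d X"
    using nQ by (simp add: slack_def k_def)
  have "sum d X \<le> (\<Sum>i\<in>X. int n - 1)" using assms d_le by (intro sum_mono) auto
  then have "sum d X \<le> k * (int n - 1)" by (simp add: k_def)
  from sum_estimate_arith[OF 1 2 this] show ?thesis using tot by simp
qed

text \<open>If removing \<open>v\<close> raises the slack by \<open>e\<close>, then adding \<open>u\<close> instead lowers it by at least \<open>e\<close>.\<close>

lemma slack_swap:
  assumes "X \<subseteq> {..<n}" "Q \<subseteq> {..<n}" "X \<inter> Q = {}" "v \<in> X" "u \<in> {..<n} - X - Q" "d v \<le> d u"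
  shows "slack (X - {v}) Q \<le> 2 * slack X Q"
proof -
  have fin: "finite X" using assms(1) finite_subset by blast
  have "0 \<le> slack (X \<union> {u}) Q" using assms by (intro slack_nonneg) auto
  also have "\<dots> = slack X Q + (int n - 1 - int (card Q) - d u)"
    using fin assms by (subst slack_Un_left) auto
  finally have 1: "d u \<le> slack X Q + (int n - 1 - int (card Q))" by simp
  have "slack X Q = slack ((X - {v}) \<union> {v}) Q" using assms(4) by (simp add: insert_absorb)
  also have "\<dots> = slack (X - {v}) Q + (int n - 1 - int (card Q) - d v)"
    using fin by (subst slack_Un_left) auto
  finally show ?thesis using 1 assms(6) by linarith
qed

text \<open>By Erdos-Gallai the first \<open>k\<close> degrees sum to at most
  \<open>k * (k - 1)\<close> plus the sum of the others, which is therefore counted twice.\<close>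

lemma low_degree_bound:
  assumes "1 \<le> k" "k < n" "d k \<le> c"
  shows "(\<Sum>i<n. d i) \<le> int k * (int k - 1) + 2 * ((int n - int k) * c)"
proof -
  have V: "{..<n} = {..<k} \<union> {k..<n}" "{..<k} \<inter> {k..<n} = {}" using assms(2) by auto
  have "(\<Sum>i<n. d i) = sum d {..<k} + sum d {k..<n}"
    unfolding V(1) by (rule sum.union_disjoint) auto
  moreover have "sum d {..<k} \<le> int k * (int n - 1 - int (n - k)) + sum d {k..<n}"
    using cut_nonneg[of "{..<k}" "{k..<n}"] assms(2) by force
  moreover have "sum d {k..<n} \<le> (int n - int k) * c"
    using sum_mono[of "{k..<n}" d "\<lambda>_. c"] antimono[of k] assms by (force simp: of_nat_diff)
  ultimately show ?thesis using assms(2) by (simp add: of_nat_diff algebra_simps)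
qed

text \<open>Otherwise \<open>low_degree_bound\<close> gives exactly the degree sum of the extremal
  join, two below the hypothesis.\<close>

lemma d_Y: "int p + 1 \<le> d (p + 1)"
proof (rule ccontr)
  assume "\<not> ?thesis"
  then have "(\<Sum>i<n. d i) \<le> int (p + 1) * (int (p + 1) - 1) + 2 * ((int n - int (p + 1)) * int p)"
    using n_ge by (intro low_degree_bound) auto
  then show False using sum_ge by (simp add: algebra_simps)
qed

lemma d_b: "int p \<le> d (p + 2)"
proof (rule ccontr)
  assume "\<not> ?thesis"
  then have "(\<Sum>i<n. d i) \<le> int (p + 2) * (int (p + 2) - 1) + 2 * ((int n - int (p + 2)) * (int p - 1))"
    using n_ge by (intro low_degree_bound) auto
  then show False using sum_ge n_ge by (simp add: algebra_simps)
qed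

text \<open>The bounds \<open>n - 1\<close> for the first \<open>p - 1\<close> degrees and
  \<open>p + 1\<close> for the others add up exactly to the assumed lower bound of the sum, so all
  of them are attained.\<close>

lemma core_low_imp_extremal:
  assumes "d (p - 1) < int p + 2"
  shows "\<forall>i<p - 1. d i = int n - 1" "\<forall>i\<in>{p - 1..<n}. d i = int p + 1"
proof -
  define U where "U = (\<lambda>i. if i < p - 1 then int n - 1 else int p + 1)"
  have dU: "d i \<le> U i" if "i < n" for i
    using that assms d_le[of i] antimono[of "p - 1" i] by (auto simp: U_def)
  have V: "{..<n} = {..<p - 1} \<union> {p - 1..<n}" using n_ge by auto
  have "(\<Sum>i<n. U i) = sum U {..<p - 1} + sum U {p - 1..<n}"
    unfolding V by (rule sum.union_disjoint) auto
  also have "\<dots> = (int p - 1) * (int n - 1) + (int n - int p + 1) * (int p + 1)"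
    using p2 n_ge by (simp add: U_def of_nat_diff)
  also have "\<dots> \<le> (\<Sum>i<n. d i)" using sum_ge by (simp add: algebra_simps)
  finally have "(\<Sum>i<n. U i - d i) \<le> 0" by (simp add: sum_subtractf)
  moreover have "0 \<le> (\<Sum>i<n. U i - d i)" using dU by (intro sum_nonneg) auto
  ultimately have "(\<Sum>i<n. U i - d i) = 0" by linarith
  then have "d i = U i" if "i < n" for i
    using that dU by (subst (asm) sum_nonneg_eq_0_iff) auto
  then show "\<forall>i<p - 1. d i = int n - 1" "\<forall>i\<in>{p - 1..<n}. d i = int p + 1"
    using n_ge by (auto simp: U_def)
qed

section \<open>A single cut, split along the core\<close>

context
  fixes P Q :: "nat set"
  assumes d_core: "int p + 2 \<le> d (p - 1)"
    and PV: "P \<subseteq> {..<n}" and QV: "Q \<subseteq> {..<n}" and PQ: "P \<inter> Q = {}"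
begin

abbreviation (input) "S \<equiv> {..<p + 3}"
abbreviation (input) "Y \<equiv> {p, p + 1}"
text \<open>Writing \<open>T\<close> for \<open>core_rel p\<close>, a cut \<open>(P, Q)\<close> is controlled by its parts inside and outside \<open>S\<close>: \<open>w\<close> counts
  the vertices outside \<open>S \<union> Qo\<close>, and \<open>\<mu>\<close> the pairs of \<open>(S - P) \<times> SQ\<close> that are missing from \<open>T\<close>.\<close>

definition "SP = P \<inter> S"
definition "SQ = Q \<inter> S"
definition "Po = P - S"
definition "Qo = Q - S"
definition "sP = int (card SP)"
definition "sQ = int (card SQ)"
definition "m = int (card Po)"
definition "w = int n - (int p + 3) - int (card Qo)"
definition "f0 = slack SP Qo"
definition "\<mu> = of_bool (p + 2 \<in> Q) * int (card (Y - P)) + of_bool (p + 2 \<notin> P) * int (card (Y \<inter> Q))"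

lemma finPQ: "finite P" "finite Q" "finite SP" "finite SQ" "finite Po" "finite Qo"
  using PV QV finite_subset[of _ "{..<n}"] by (auto simp: SP_def SQ_def Po_def Qo_def)

lemma Sn: "S \<subseteq> {..<n}" using n_ge by auto

lemma m_le_w: "0 \<le> m" "m \<le> w"
proof -
  have "card (Po \<union> Qo) \<le> card ({..<n} - S)"
    using PV QV by (intro card_mono) (auto simp: Po_def Qo_def)
  moreover have "card (Po \<union> Qo) = card Po + card Qo"
    using finPQ PQ by (intro card_Un_disjoint) (auto simp: Po_def Qo_def)
  moreover have "card ({..<n} - S) = n - (p + 3)" using Sn by (simp add: card_Diff_subset)
  ultimately have "card Po + card Qo + (p + 3) \<le> n" using n_ge by linarith
  then show "0 \<le> m" "m \<le> w" by (auto simp: m_def w_def)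
qed

lemma sP_sQ: "0 \<le> sP" "0 \<le> sQ" "sP + sQ \<le> int p + 3"
proof -
  have "card (SP \<union> SQ) \<le> card S" by (intro card_mono) (auto simp: SP_def SQ_def)
  moreover have "card (SP \<union> SQ) = card SP + card SQ"
    using finPQ PQ by (intro card_Un_disjoint) (auto simp: SP_def SQ_def)
  ultimately show "sP + sQ \<le> int p + 3" by (simp add: sP_def sQ_def)
qed (auto simp: sP_def sQ_def)

lemma SP_SQ_full: "sP + sQ = int p + 3 \<Longrightarrow> SP \<union> SQ = S"
proof (rule card_subset_eq)
  assume "sP + sQ = int p + 3"
  moreover have "card (SP \<union> SQ) = card SP + card SQ"
    using finPQ PQ by (intro card_Un_disjoint) (auto simp: SP_def SQ_def)
  ultimately show "card (SP \<union> SQ) = card S" by (simp add: sP_def sQ_def)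
qed (auto simp: SP_def SQ_def)

text \<open>Both \<open>SQ\<close> and \<open>Po\<close> move to the complement, which reduces the
  cut to \<open>(SP, Qo)\<close>.\<close>

lemma slack_PQ:
  "slack P Q = f0 + (\<Sum>u\<in>SQ. d u - sP) + (\<Sum>u\<in>Po. int p + 2 + w - sQ - d u)"
proof -
  have P: "P = SP \<union> Po" "SP \<inter> Po = {}" and Q: "Q = Qo \<union> SQ" "Qo \<inter> SQ = {}"
    by (auto simp: SP_def Po_def SQ_def Qo_def)
  have cQ: "int (card Q) = int (card Qo) + sQ"
    using card_Un_disjoint[OF finPQ(6,4) Q(2)] Q(1) by (simp add: sQ_def)
  have "slack P Q = slack SP Q + (\<Sum>u\<in>Po. int n - 1 - int (card Q) - d u)"
    using slack_Un_left[OF finPQ(3,5) P(2), of Q] P(1) by simp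
  moreover have "slack SP Q = f0 + (\<Sum>u\<in>SQ. d u - sP)"
    using slack_Un_right[OF finPQ(6,4) Q(2), of SP] Q(1) by (simp add: f0_def sP_def)
  moreover have "int n - 1 - int (card Q) = int p + 2 + w - sQ" using cQ by (simp add: w_def)
  ultimately show ?thesis by simp
qed

text \<open>Here \<open>SQ\<close> changes over to the side of \<open>P\<close> instead, which is
  the better comparison when its degrees are large.\<close>

lemma slack_PQ':
  "slack P Q = slack (P \<union> SQ) Qo + (\<Sum>u\<in>SQ. 2 * d u - sP - m - (int p + 2 + w))"
proof -
  have Q: "Q = Qo \<union> SQ" "Qo \<inter> SQ = {}" and PSQ: "P \<inter> SQ = {}"
    using PQ by (auto simp: SQ_def Qo_def)
  have P: "P = SP \<union> Po" "SP \<inter> Po = {}" by (auto simp: SP_def Po_def)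
  have cP: "int (card P) = sP + m"
    using card_Un_disjoint[OF finPQ(3,5) P(2)] P(1) by (simp add: sP_def m_def)
  have "slack P Q = slack P Qo + (\<Sum>u\<in>SQ. d u - int (card P))"
    using slack_Un_right[OF finPQ(6,4) Q(2), of P] Q(1) by simp
  moreover have "slack (P \<union> SQ) Qo = slack P Qo + (\<Sum>u\<in>SQ. int n - 1 - int (card Qo) - d u)"
    using finPQ PSQ by (simp add: slack_Un_left)
  moreover have "int n - 1 - int (card Qo) = int p + 2 + w" by (simp add: w_def)
  ultimately have "slack P Q = slack (P \<union> SQ) Qo + ((\<Sum>u\<in>SQ. d u - (sP + m)) - (\<Sum>u\<in>SQ. int p + 2 + w - d u))"
    using cP by simp
  also have "(\<Sum>u\<in>SQ. d u - (sP + m)) - (\<Sum>u\<in>SQ. int p + 2 + w - d u)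
      = (\<Sum>u\<in>SQ. d u - (sP + m) - (int p + 2 + w - d u))"
    by (rule sum_subtractf[symmetric])
  also have "\<dots> = (\<Sum>u\<in>SQ. 2 * d u - sP - m - (int p + 2 + w))"
    by (rule sum.cong) auto
  finally show ?thesis .
qed

lemma parts_subset: "SP \<subseteq> {..<n}" "Qo \<subseteq> {..<n}" "SP \<inter> Qo = {}" "P \<union> SQ \<subseteq> {..<n}" "(P \<union> SQ) \<inter> Qo = {}"
  using PV QV PQ by (auto simp: SP_def Qo_def SQ_def)

lemma f0_nonneg: "0 \<le> f0"
  unfolding f0_def using parts_subset by (intro slack_nonneg)

lemma mu_nonneg: "0 \<le> \<mu>" by (simp add: \<mu>_def)

text \<open>The assumed degree sum meets \<open>sum_estimate\<close> for \<open>(SP, Qo)\<close>;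
  outside \<open>SP \<union> Qo\<close> there are \<open>j + w\<close> vertices.\<close>

lemma f0_estimate:
  defines "j \<equiv> int p + 3 - sP"
  shows "2 * (j - 3) * (int n - int p) + (j - 3) * (j - 4) + 2 \<le> (j + w) * (j + w - 1) + 2 * f0"
proof -
  have sP: "sP = int p + 3 - j" by (simp add: j_def)
  have "int n - int (card Qo) - int (card SP) = j + w" by (simp add: j_def w_def sP_def)
  then have "(\<Sum>i<n. d i) \<le> 2 * sP * (int n - 1) - sP * (sP - 1) + (j + w) * (j + w - 1) + 2 * f0"
    using sum_estimate[OF parts_subset(1-3)] by (simp add: f0_def sP_def)
  then show ?thesis using sum_ge unfolding sP by (simp add: algebra_simps)
qed

text \<open>Some \<open>v\<close> in \<open>SP\<close> can be exchanged for some \<open>u\<close> of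
  at least the same degree outside. Without \<open>v\<close> the degree sum forces a slack of at
  least 10, and by \<open>slack_swap\<close> half of it remains for \<open>f0\<close>.\<close>

lemma f0_swap:
  assumes "sP = int p" "SP \<noteq> {..<p}" "w \<le> 2"
  shows "5 \<le> f0"
proof -
  have cSP: "card SP = p" using assms(1) by (simp add: sP_def)
  have "\<not> {..<p} \<subseteq> SP"
    using card_subset_eq[OF finPQ(3), of "{..<p}"] cSP assms(2) by auto
  then obtain u where u: "u < p" "u \<notin> SP" by auto
  have "\<not> SP \<subseteq> {..<p}"
    using card_subset_eq[of "{..<p}" SP] cSP assms(2) by auto
  then obtain v where v: "v \<in> SP" "v \<ge> p" by (metis lessThan_iff not_less subsetI)
  have uv: "u \<in> {..<n} - SP - Qo" "d v \<le> d u"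
    using u v parts_subset n_ge by (auto simp: Qo_def intro!: antimono)
  have c: "int (card (SP - {v})) = int p - 1"
    using v(1) cSP p2 finPQ by (simp add: of_nat_diff)
  have uu: "int n - int (card Qo) - int (card (SP - {v})) = 4 + w"
    using c by (simp add: w_def)
  have "SP - {v} \<subseteq> {..<n}" "(SP - {v}) \<inter> Qo = {}" using parts_subset by auto
  from sum_estimate[OF this(1) parts_subset(2) this(2)]
  have "(\<Sum>i<n. d i) \<le> 2 * (int p - 1) * (int n - 1) - (int p - 1) * (int p - 2) + (4 + w) * (3 + w) + 2 * slack (SP - {v}) Qo"
    unfolding uu unfolding c by simp
  moreover have "(4 + w) * (3 + w) \<le> 6 * 5"
    using assms(3) m_le_w by (intro mult_mono) auto
  \<comment> \<open>The estimate gives \<open>n - p - 14\<close>, which is at least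
    \<open>3 * p + 4\<close>.\<close>
  ultimately have "10 \<le> slack (SP - {v}) Qo"
    using sum_ge p2 n_ge by (simp add: algebra_simps)
  then show ?thesis
    using slack_swap[OF parts_subset(1-3) v(1) uv] by (simp add: f0_def)
qed

lemma sum_total:
  "(\<Sum>i<n. d i) = sum d SP + sum d Qo + sum d ({..<n} - SP - Qo)"
proof -
  define U where "U = {..<n} - SP - Qo"
  have U: "{..<n} = (SP \<union> Qo) \<union> U" "(SP \<union> Qo) \<inter> U = {}" "finite U" using parts_subset by (auto simp: U_def)
  have "sum d ((SP \<union> Qo) \<union> U) = sum d (SP \<union> Qo) + sum d U"
    using U finPQ by (intro sum.union_disjoint) auto
  moreover have "sum d (SP \<union> Qo) = sum d SP + sum d Qo"
    using parts_subset finPQ by (intro sum.union_disjoint) auto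
  ultimately show ?thesis unfolding U_def[symmetric] using U(1) by simp
qed

text \<open>With both inequalities tight, \<open>P\<close> and \<open>Q\<close> cover all vertices.
  This makes the total degree sum computable in the parity arguments below.\<close>

lemma full_partition:
  assumes "sP + sQ = int p + 3" "m = w"
  shows "{..<n} - SP - Qo = SQ \<union> Po"
proof -
  have "card (Po \<union> Qo) = card ({..<n} - S)"
    using assms(2) Sn n_ge finPQ PQ
    by (subst card_Un_disjoint) (auto simp: Po_def Qo_def m_def w_def card_Diff_subset)
  moreover have "Po \<union> Qo \<subseteq> {..<n} - S" using PV QV by (auto simp: Po_def Qo_def)
  ultimately have PoQo: "Po \<union> Qo = {..<n} - S" by (intro card_subset_eq) auto
  have "SP \<union> SQ = S" using SP_SQ_full assms(1) by simp
  have "(SP \<union> SQ) \<union> (Po \<union> Qo) = {..<n}"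
    unfolding \<open>SP \<union> SQ = S\<close> PoQo using Sn by (rule Diff_partition)
  moreover have "SQ \<inter> (SP \<union> Qo) = {}" "Po \<inter> (SP \<union> Qo) = {}"
    using PQ by (auto simp: SP_def SQ_def Po_def Qo_def)
  ultimately show ?thesis by blast
qed

lemma SP_core_SQ:
  assumes "SP = {..<p}"
  shows "P \<inter> Y = {}" "p + 2 \<notin> P"
proof -
  have "x \<notin> P" if "p \<le> x" "x < p + 3" for x
  proof
    assume "x \<in> P"
    then have "x \<in> SP" using that by (simp add: SP_def)
    then show False using assms that by simp
  qed
  then show "P \<inter> Y = {}" "p + 2 \<notin> P" by auto
qed

text \<open>Degrees are at least \<open>p + 2 + \<delta>\<close> in \<open>SQ\<close> and at most
  that in \<open>Po\<close>, so it suffices that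
  \<open>f0 + sQ * \<delta> + m * (w - sQ - \<delta>) + \<mu>\<close> is nonnegative. If
  \<open>m \<le> \<delta>\<close> and \<open>m + w \<le> 2 * \<delta>\<close>, the comparison
  \<open>slack_PQ'\<close> is used instead. In the other cases the two middle terms suffice, unless
  \<delta> < m and \<open>w < sQ\<close>; then \<open>f0\<close> or \<mu> has to pay.\<close>

lemma slack_bound_high:
  assumes \<delta>: "\<delta> = d (p + 2) - int p - 2" "0 \<le> \<delta>"
  shows "sQ * (int p + 2 - sP) - \<mu> \<le> slack P Q"
proof -
  have dS: "int p + 2 + \<delta> \<le> d u" if "u \<in> SQ" for u
    using antimono[of u "p + 2"] that n_ge \<delta> by (auto simp: SQ_def)
  have dO: "d u \<le> int p + 2 + \<delta>" if "u \<in> Po" for u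
    using antimono[of "p + 2" u] that PV \<delta> by (auto simp: Po_def)
  have s1: "sQ * (int p + 2 + \<delta>) \<le> (\<Sum>u\<in>SQ. d u)"
    using sum_mono[of SQ "\<lambda>_. int p + 2 + \<delta>" d] dS by (simp add: sQ_def)
  have s2: "(\<Sum>u\<in>Po. d u) \<le> m * (int p + 2 + \<delta>)"
    using sum_mono[of Po d "\<lambda>_. int p + 2 + \<delta>"] dO by (simp add: m_def)
  have E1: "slack P Q = f0 + (\<Sum>u\<in>SQ. d u) - sQ * sP + m * (int p + 2 + w - sQ) - (\<Sum>u\<in>Po. d u)"
    using slack_PQ by (simp add: sum_subtractf sQ_def m_def)
  have lower: "f0 + sQ * \<delta> + m * (w - sQ - \<delta>) + sQ * (int p + 2 - sP) \<le> slack P Q"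
    using E1 s1 s2 by (simp add: algebra_simps)
  note nn = f0_nonneg mu_nonneg m_le_w sP_sQ
  show ?thesis
  proof (cases "m \<le> \<delta>")
    case True
    show ?thesis
    proof (cases "m + w \<le> 2 * \<delta>")
      case True
      have "slack P Q = slack (P \<union> SQ) Qo + 2 * (\<Sum>u\<in>SQ. d u) - sQ * (sP + m + (int p + 2 + w))"
        using slack_PQ' by (simp add: sum_subtractf sQ_def sum_distrib_left algebra_simps)
      moreover have "0 \<le> slack (P \<union> SQ) Qo" using parts_subset by (intro slack_nonneg)
      ultimately have "sQ * (int p + 2 - sP) + sQ * (2 * \<delta> - m - w) \<le> slack P Q"
        using s1 by (simp add: algebra_simps)
      moreover have "0 \<le> sQ * (2 * \<delta> - m - w)" using True nn by simp
      ultimately show ?thesis using nn by linarith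
    next
      case False
      have "0 \<le> (m + sQ) * (\<delta> - m)" using True nn by simp
      moreover have "m * (2 * \<delta> - m) \<le> m * w" using False nn by (intro mult_left_mono) auto
      ultimately have "0 \<le> sQ * \<delta> + m * (w - sQ - \<delta>)" by (simp add: algebra_simps)
      then show ?thesis using lower nn by linarith
    qed
  next
    case m\<delta>: False
    show ?thesis
    proof (cases "sQ \<le> m")
      case True
      have "0 \<le> (m - sQ) * (m - \<delta>)" using True m\<delta> by simp
      moreover have "m * m \<le> m * w" using nn by (intro mult_left_mono) auto
      ultimately have "0 \<le> sQ * \<delta> + m * (w - sQ - \<delta>)" by (simp add: algebra_simps)
      then show ?thesis using lower nn by linarith
    next
      case sQm: False
      show ?thesis
      proof (cases "sQ \<le> w")
        case True
        have "0 \<le> (sQ - m) * \<delta>" "0 \<le> m * (w - sQ)" using True sQm \<delta> nn by simp_all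
        then have "0 \<le> sQ * \<delta> + m * (w - sQ - \<delta>)" by (simp add: algebra_simps)
        then show ?thesis using lower nn by linarith
      next
        case wsQ: False
        have "0 \<le> (sQ - m) * \<delta>" using sQm \<delta> by simp
        then have lower': "f0 - m * (sQ - w) + sQ * (int p + 2 - sP) \<le> slack P Q"
          using lower by (simp add: algebra_simps)
        define j where "j = int p + 3 - sP"
        have j: "sQ \<le> j" "j \<le> int p + 3" using nn by (auto simp: j_def)
        \<comment> \<open>Now \<delta> < m \<le> w < sQ \<le> j, and a loss of
          \<open>m * (sQ - w)\<close> has to be covered. The degree sum does so for \<open>j\<close>
          at least 4.\<close>
        consider "4 \<le> j" | "j = 3" | "j = 2" using j sQm m\<delta> \<delta> by linarith
        then show ?thesis
        proof cases
          case 1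
          have "m * (sQ - w) \<le> w * (j - w)" using nn wsQ j by (intro mult_mono) auto
          moreover have "2 * (w * (j - w)) \<le> 2 * f0"
            using f0_estimate estimate_arith_weak[OF 1 j(2), of "int n" w] p2 n_ge nn wsQ j
            unfolding j_def[symmetric] by (simp add: algebra_simps)
          ultimately show ?thesis using lower' nn by linarith
        next
          case 2
          have sP: "sP = int p" using 2 by (simp add: j_def)
          have w2: "w \<le> 2" using wsQ j 2 by simp
          have ms: "m * (sQ - w) \<le> sQ - 1"
          proof -
            have "m = 1 \<or> m = 2" using m\<delta> \<delta> w2 nn by linarith
            then show ?thesis using nn wsQ j 2 by auto
          qed
          show ?thesis
          \<comment> \<open>If \<open>SP\<close> consists of the first \<open>p\<close> vertices,
            then \<mu> counts every vertex of \<open>SQ\<close> at least once. Otherwise the swap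
            makes \<open>f0\<close> large.\<close>
          proof (cases "SP = {..<p}")
            case True
            have Y: "Y - P = Y" "p + 2 \<notin> P" using SP_core_SQ[OF True] by auto
            have "SQ \<subseteq> {p, p + 1, p + 2}"
            proof -
              have "SQ \<inter> {..<p} = {}" using True PQ by (auto simp: SP_def SQ_def)
              then show ?thesis by (auto simp: SQ_def)
            qed
            then have SQ: "SQ = (Y \<inter> Q) \<union> ({p + 2} \<inter> Q)" by (auto simp: SQ_def)
            have "card SQ = card (Y \<inter> Q) + card ({p + 2} \<inter> Q)"
              unfolding SQ by (rule card_Un_disjoint) auto
            then have "sQ = int (card (Y \<inter> Q)) + of_bool (p + 2 \<in> Q)" by (simp add: sQ_def)
            moreover have "\<mu> = of_bool (p + 2 \<in> Q) * 2 + int (card (Y \<inter> Q))"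
              using Y by (simp add: \<mu>_def)
            ultimately have "sQ \<le> \<mu>" by (simp split: if_splits)
            then show ?thesis using lower' ms nn by linarith
          next
            case False
            then have "5 \<le> f0" using f0_swap sP w2 by simp
            then show ?thesis using lower' ms nn j 2 by linarith
          qed
        next
          case 3
          have v: "sQ = 2" "m = 1" "w = 1" "\<delta> = 0" "sP = int p + 1"
            using 3 j nn wsQ sQm m\<delta> \<delta> j_def by linarith+
          \<comment> \<open>The deficit could only be 1. Then all estimates are tight,
            \<open>SQ \<union> Po\<close> is everything outside \<open>SP \<union> Qo\<close>, and
            the degree sum would be odd.\<close>
          show ?thesis
          proof (rule ccontr)
            assume "\<not> ?thesis"
            then have *: "f0 = 0" "sum d SQ = 2 * (int p + 2)" "sum d Po = int p + 2"
              using E1 s1 s2 nn v by auto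
            have "{..<n} - SP - Qo = SQ \<union> Po" using full_partition v by simp
            moreover have "sum d (SQ \<union> Po) = sum d SQ + sum d Po"
              using finPQ by (intro sum.union_disjoint) (auto simp: SQ_def Po_def)
            ultimately have "(\<Sum>i<n. d i) = sum d SP + sum d Qo + 3 * (int p + 2)"
              using sum_total * by simp
            moreover have "f0 = (int p + 1) * (int p + 3) + sum d Qo - sum d SP"
              using v by (simp add: f0_def slack_def sP_def w_def)
            ultimately have "(\<Sum>i<n. d i) = 2 * sum d SP - (int p + 1) * (int p + 3) + 3 * (int p + 2)"
              using * by simp
            then show False using even_sum by simp
          qed
        qed
      qed
    qed
  qed
qed

text \<open>Even after removing \<open>p + 2\<close> from \<open>SP\<close> the slack is
  nonnegative.\<close>

lemma f0_b_in_P: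
  assumes "p + 2 \<in> P"
  shows "int p + 2 + w - d (p + 2) \<le> f0"
proof -
  have b: "p + 2 \<in> SP" using assms by (simp add: SP_def)
  have "f0 = slack ((SP - {p + 2}) \<union> {p + 2}) Qo" using b by (simp add: f0_def insert_absorb)
  also have "\<dots> = slack (SP - {p + 2}) Qo + (int n - 1 - int (card Qo) - d (p + 2))"
    using finPQ by (subst slack_Un_left) auto
  also have "int n - 1 - int (card Qo) = int p + 2 + w" by (simp add: w_def)
  finally have "f0 = slack (SP - {p + 2}) Qo + (int p + 2 + w - d (p + 2))" .
  moreover have "0 \<le> slack (SP - {p + 2}) Qo" using parts_subset by (intro slack_nonneg) auto
  ultimately show ?thesis by simp
qed

text \<open>Add the missing vertices of \<open>{..<p}\<close> to \<open>SP\<close> and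
  \<open>p + 2\<close> to \<open>Qo\<close>; the new slack is nonnegative. If all added vertices
  have degree at least \<open>p + 2 + w\<close>, adding them has not raised the slack. Otherwise the
  vertices of \<open>Y \<inter> P\<close>, of still smaller degree, contribute at least 1 each to
  \<open>f0\<close>, and \<open>d_b\<close> does the rest.\<close>

lemma f0_b_in_Q:
  assumes b: "p + 2 \<in> Q"
  shows "int p - d (p + 2) + int (card (Y \<inter> P)) \<le> f0"
proof -
  have bP: "p + 2 \<notin> P" using b PQ by auto
  have nQ: "int n - 1 - int (card Qo) = int p + 2 + w" by (simp add: w_def)
  define X where "X = {..<p} - P"
  have X: "finite X" "SP \<inter> X = {}" "SP \<union> X = {..<p} \<union> (Y \<inter> P)" "X \<subseteq> {..<n}" "X \<inter> Qo = {}"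
  proof -
    have "x < p \<or> x \<in> Y" if "x \<in> P" "x < p + 3" for x
      using that bP by (cases "x = p + 2") auto
    then show "SP \<union> X = {..<p} \<union> (Y \<inter> P)" by (auto simp: SP_def X_def)
  qed (use n_ge in \<open>auto simp: X_def SP_def Qo_def\<close>)
  show ?thesis
  proof (cases "\<forall>x\<in>X. int p + 2 + w \<le> d x")
    case True
    have "0 \<le> slack (SP \<union> X) (Qo \<union> {p + 2})"
      using parts_subset X bP n_ge by (intro slack_nonneg) (auto simp: Qo_def X_def SP_def)
    also have "\<dots> = slack (SP \<union> X) Qo + (d (p + 2) - int (card (SP \<union> X)))"
      using finPQ by (subst slack_Un_right) (auto simp: Qo_def)
    also have "slack (SP \<union> X) Qo = f0 + (\<Sum>u\<in>X. int p + 2 + w - d u)"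
      using slack_Un_left[OF finPQ(3) X(1,2), of Qo] nQ by (simp add: f0_def)
    also have "card (SP \<union> X) = p + card (Y \<inter> P)"
      unfolding X(3) by (subst card_Un_disjoint) auto
    finally have "int p + int (card (Y \<inter> P)) \<le> f0 + (\<Sum>u\<in>X. int p + 2 + w - d u) + d (p + 2)"
      by simp
    moreover have "(\<Sum>u\<in>X. int p + 2 + w - d u) \<le> 0" using True by (intro sum_nonpos) auto
    ultimately show ?thesis by linarith
  next
    case False
    then obtain x where x: "x < p" "d x < int p + 2 + w" by (auto simp: X_def)
    have dy: "1 \<le> int p + 2 + w - d y" if "y \<in> Y \<inter> P" for y
      using antimono[of x y] that x n_ge by auto
    have "SP = (SP - Y) \<union> (Y \<inter> P)" by (auto simp: SP_def)
    then have "f0 = slack ((SP - Y) \<union> (Y \<inter> P)) Qo" unfolding f0_def by (rule arg_cong)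
    also have "\<dots> = slack (SP - Y) Qo + (\<Sum>u\<in>Y \<inter> P. int p + 2 + w - d u)"
      unfolding nQ[symmetric] using finPQ by (intro slack_Un_left) auto
    finally have "f0 = slack (SP - Y) Qo + (\<Sum>u\<in>Y \<inter> P. int p + 2 + w - d u)" .
    moreover have "0 \<le> slack (SP - Y) Qo" using parts_subset by (intro slack_nonneg) auto
    moreover have "int (card (Y \<inter> P)) \<le> (\<Sum>u\<in>Y \<inter> P. int p + 2 + w - d u)"
      using sum_mono[of "Y \<inter> P" "\<lambda>_. 1" "\<lambda>u. int p + 2 + w - d u"] dy by simp
    ultimately show ?thesis using d_b by linarith
  qed
qed

text \<open>By \<open>d_b\<close> the degree of \<open>p + 2\<close> falls short of
  \<open>p + 2\<close> by \<open>e\<close>, which is 1 or 2, and degrees in \<open>Y\<close> may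
  fall short by 1. Low degrees in \<open>Po\<close> help in return: \<open>m\<close> is multiplied
  by \<open>sQ - e - w\<close> only.\<close>

lemma slack_bound_low:
  assumes low: "d (p + 2) \<le> int p + 1"
  shows "sQ * (int p + 2 - sP) - \<mu> \<le> slack P Q"
proof -
  define e where "e = int p + 2 - d (p + 2)"
  have e: "1 \<le> e" "e \<le> 2" using low d_b by (auto simp: e_def)
  define \<beta>Q :: int where "\<beta>Q = of_bool (p + 2 \<in> Q)"
  define yQ where "yQ = int (card (Y \<inter> Q))"
  have SQ: "SQ = ({..<p} \<inter> Q) \<union> ((Y \<inter> Q) \<union> ({p + 2} \<inter> Q))"
  proof -
    have "x < p \<or> x = p \<or> x = p + 1 \<or> x = p + 2" if "x < p + 3" for x using that by linarith
    then show ?thesis by (auto simp: SQ_def)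
  qed
  have cQ: "sQ = int (card ({..<p} \<inter> Q)) + yQ + \<beta>Q"
    and dQ: "sum d SQ = sum d ({..<p} \<inter> Q) + sum d (Y \<inter> Q) + \<beta>Q * d (p + 2)"
  proof -
    have dis: "({..<p} \<inter> Q) \<inter> ((Y \<inter> Q) \<union> ({p + 2} \<inter> Q)) = {}" "(Y \<inter> Q) \<inter> ({p + 2} \<inter> Q) = {}" by auto
    have b: "card ({p + 2} \<inter> Q) = of_bool (p + 2 \<in> Q)" "sum d ({p + 2} \<inter> Q) = \<beta>Q * d (p + 2)"
      by (auto simp: \<beta>Q_def)
    have "card SQ = card ({..<p} \<inter> Q) + card ((Y \<inter> Q) \<union> ({p + 2} \<inter> Q))"
      by (subst SQ, rule card_Un_disjoint[OF _ _ dis(1)]) auto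
    also have "card ((Y \<inter> Q) \<union> ({p + 2} \<inter> Q)) = card (Y \<inter> Q) + card ({p + 2} \<inter> Q)"
      by (rule card_Un_disjoint[OF _ _ dis(2)]) auto
    finally show "sQ = int (card ({..<p} \<inter> Q)) + yQ + \<beta>Q" unfolding b(1) by (simp add: sQ_def yQ_def \<beta>Q_def)
    have "sum d SQ = sum d ({..<p} \<inter> Q) + sum d ((Y \<inter> Q) \<union> ({p + 2} \<inter> Q))"
      by (subst SQ, rule sum.union_disjoint[OF _ _ dis(1)]) auto
    also have "sum d ((Y \<inter> Q) \<union> ({p + 2} \<inter> Q)) = sum d (Y \<inter> Q) + sum d ({p + 2} \<inter> Q)"
      by (rule sum.union_disjoint[OF _ _ dis(2)]) auto
    finally show "sum d SQ = sum d ({..<p} \<inter> Q) + sum d (Y \<inter> Q) + \<beta>Q * d (p + 2)" unfolding b(2) by simp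
  qed
  have s1: "sQ * (int p + 2) - e * \<beta>Q - yQ \<le> sum d SQ"
  proof -
    have "int p + 2 \<le> d x" if "x < p" for x
    proof -
      have "d (p - 1) \<le> d x" using that n_ge by (intro antimono) auto
      then show ?thesis using d_core by linarith
    qed
    then have "int (card ({..<p} \<inter> Q)) * (int p + 2) \<le> sum d ({..<p} \<inter> Q)"
      using sum_mono[of "{..<p} \<inter> Q" "\<lambda>_. int p + 2" d] by simp
    moreover have "int p + 1 \<le> d y" if "y \<in> Y" for y
      using antimono[of y "p + 1"] that d_Y n_ge by auto
    then have "yQ * (int p + 1) \<le> sum d (Y \<inter> Q)"
      using sum_mono[of "Y \<inter> Q" "\<lambda>_. int p + 1" d] by (simp add: yQ_def)
    moreover have "\<beta>Q * d (p + 2) = \<beta>Q * (int p + 2) - e * \<beta>Q" by (simp add: e_def algebra_simps)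
    moreover have "yQ * (int p + 2) - yQ = yQ * (int p + 1)" by (simp add: algebra_simps)
    ultimately show ?thesis unfolding dQ cQ by (simp add: distrib_right)
  qed
  have "d u \<le> int p + 2 - e" if "u \<in> Po" for u
    using antimono[of "p + 2" u] that PV by (auto simp: Po_def e_def)
  then have s2: "sum d Po \<le> m * (int p + 2 - e)"
    using sum_mono[of Po d "\<lambda>_. int p + 2 - e"] by (simp add: m_def)
  have E1: "slack P Q = f0 + sum d SQ - sQ * sP + m * (int p + 2 + w - sQ) - sum d Po"
    using slack_PQ by (simp add: sum_subtractf sQ_def m_def)
  have lower: "f0 - e * \<beta>Q - yQ - m * (sQ - e - w) + sQ * (int p + 2 - sP) \<le> slack P Q"
    using E1 s1 s2 by (simp add: algebra_simps)
  note nn = f0_nonneg mu_nonneg m_le_w sP_sQ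
  define yP where "yP = int (card (Y \<inter> P))"
  have YP: "int (card (Y - P)) = 2 - yP" "0 \<le> yP" "yP \<le> 2"
  proof -
    have "card (Y - P) + card (Y \<inter> P) = card Y"
      using card_Int_Diff[of Y P] by (simp add: add.commute)
    then show "int (card (Y - P)) = 2 - yP" "yP \<le> 2" "0 \<le> yP" by (auto simp: yP_def)
  qed
  have yQ: "0 \<le> yQ" "yQ \<le> 2" "yQ \<le> sQ"
  proof -
    have "card (Y \<inter> Q) \<le> card Y" by (rule card_mono) auto
    then show "yQ \<le> 2" by (simp add: yQ_def)
    show "yQ \<le> sQ" using cQ by (simp add: \<beta>Q_def)
  qed (simp add: yQ_def)
  \<comment> \<open>The shortfall of the degrees in \<open>SQ\<close> minus the relief \<mu> from
    pairs missing in the core. It never exceeds 2, and it exceeds \<open>f0\<close> only if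
    \<open>p + 2\<close> lies in \<open>P\<close>.\<close>
  define \<beta> where "\<beta> = e * \<beta>Q + yQ - \<mu>"
  have b_cases: "(p + 2 \<in> P \<and> \<beta> = yQ \<and> \<beta>Q = 0) \<or> (p + 2 \<notin> P \<and> p + 2 \<in> Q \<and> \<beta> = e - 2 + yP \<and> \<beta>Q = 1) \<or> (p + 2 \<notin> P \<and> p + 2 \<notin> Q \<and> \<beta> = 0 \<and> \<beta>Q = 0)"
    using PQ YP(1) by (auto simp: \<beta>_def \<mu>_def \<beta>Q_def yQ_def)
  have \<beta>2: "\<beta> \<le> 2" using b_cases e yQ YP by linarith
  have \<beta>f0: "\<beta> \<le> f0" if "p + 2 \<notin> P"
    using b_cases that f0_b_in_Q nn by (auto simp: yP_def e_def)
  have f0P: "w + e \<le> f0" if "p + 2 \<in> P"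
    using f0_b_in_P that by (simp add: e_def)
  have suff: ?thesis if "\<beta> + m * (sQ - e - w) \<le> f0"
    using lower that by (simp add: \<beta>_def)
  show ?thesis
  proof (cases "sQ - e \<le> w")
    case True
    have "\<beta> \<le> f0"
      using \<beta>f0 f0P b_cases yQ True by (cases "p + 2 \<in> P") auto
    moreover have "0 \<le> m * (w - (sQ - e))" using True nn by simp
    ultimately show ?thesis by (intro suff) (simp add: algebra_simps)
  next
    case wsQ: False
    define j where "j = int p + 3 - sP"
    have j: "sQ \<le> j" "j \<le> int p + 3" using nn by (auto simp: j_def)
    consider "4 \<le> j" | "j = 3" | "j \<le> 2" by linarith
    then show ?thesis
    proof cases
      case 1
      have "m * (sQ - e - w) \<le> w * (j - 1 - w)" using nn wsQ j e by (intro mult_mono) auto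
      with \<beta>2 have "\<beta> + m * (sQ - e - w) \<le> 2 + w * (j - 1 - w)" by (rule add_mono)
      also have "2 + w * (j - 1 - w) \<le> f0"
      proof -
        have "2 * (2 + w * (j - 1 - w)) \<le> 2 * f0"
          using f0_estimate estimate_arith_strong[OF 1 j(2), of "int n" w] p2 n_ge nn wsQ j e
          unfolding j_def[symmetric] by linarith
        then show ?thesis by simp
      qed
      finally show ?thesis by (rule suff)
    next
      case 2
      have sP: "sP = int p" using 2 by (simp add: j_def)
      have w1: "w \<le> 1" "w \<le> 2 - e" using wsQ j 2 e by linarith+
      show ?thesis
      proof (cases "SP = {..<p}")
        case True
        note Y = SP_core_SQ[OF True]
        have yP0: "yP = 0" using Y(1) by (simp add: yP_def Int_commute)
        have A0: "{..<p} \<inter> Q = {}" using True PQ by (auto simp: SP_def)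
        then have sQ: "sQ = yQ + \<beta>Q" using cQ by simp
        show ?thesis
        proof (cases "m = 0")
          case True
          then show ?thesis using \<beta>f0 Y(2) by (intro suff) simp
        next
          case False
          then have mw: "m = 1" "w = 1" "e = 1" using nn w1 e by linarith+
          then have "sQ = 3" "\<beta>Q = 1" using wsQ j 2 sQ yQ b_cases by linarith+
          then have "\<beta> = - 1" using b_cases yP0 mw by auto
          then show ?thesis using mw \<open>sQ = 3\<close> nn by (intro suff) simp
        qed
      next
        case False
        then have "5 \<le> f0" using f0_swap sP w1 by simp
        moreover have "m * (sQ - e - w) \<le> 1 * 2" using nn wsQ j 2 e w1 by (intro mult_mono) auto
        ultimately show ?thesis using \<beta>2 by (intro suff) linarith
      qed
    next
      case 3
      have v: "e = 1" "w = 0" "sQ = 2" "m = 0" "sP = int p + 1"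
        using 3 j nn wsQ e j_def by linarith+
      show ?thesis
      proof (cases "\<beta> \<le> f0")
        case True
        then show ?thesis using v by (intro suff) simp
      next
        case False
        then have bP: "p + 2 \<in> P" using \<beta>f0 by blast
        then have y2: "yQ = 2" "\<beta>Q = 0" "f0 \<ge> 1" "\<beta> = 2" using False f0P b_cases v yQ PQ by auto
        then have "\<mu> = 0" using \<beta>_def by simp
        have Po0: "Po = {}" using v(4) finPQ by (simp add: m_def)
        show ?thesis
        \<comment> \<open>As for high degrees: failure makes all estimates tight, with
          \<open>f0 = 1\<close> and \<open>Po\<close> empty, and the degree sum would be
          odd.\<close>
        proof (rule ccontr)
          assume "\<not> ?thesis"
          then have *: "f0 = 1" "sum d SQ = 2 * int p + 2"
            using E1 s1 y2 v \<open>\<mu> = 0\<close> Po0 by auto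
          have "{..<n} - SP - Qo = SQ" using full_partition v Po0 by simp
          then have "(\<Sum>i<n. d i) = sum d SP + sum d Qo + (2 * int p + 2)"
            using sum_total * by simp
          moreover have "f0 = (int p + 1) * (int p + 2) + sum d Qo - sum d SP"
            using v by (simp add: f0_def slack_def sP_def w_def)
          ultimately have "(\<Sum>i<n. d i) = 2 * sum d SP + 1 - (int p + 1) * (int p + 2) + (2 * int p + 2)"
            using * by simp
          then show False using even_sum by simp
        qed
      qed
    qed
  qed
qed

lemma slack_bound: "sQ * (int p + 2 - sP) - \<mu> \<le> slack P Q"
  using slack_bound_low slack_bound_high by (cases "d (p + 2) \<le> int p + 1") auto

text \<open>Since \<open>SQ\<close> lies in \<open>S - P\<close>, each of its vertices has
  \<open>p + 2 - sP\<close> partners there; \<mu> counts the pairs lost to the two nonadjacencies of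
  the core, in either direction.\<close>

lemma card_core_rel: "int (card (core_rel p \<inter> ({..<n} - P) \<times> Q)) = sQ * (int p + 2 - sP) - \<mu>"
proof -
  define M1 where "M1 = (Y - P) \<times> ({p + 2} \<inter> Q)"
  define M2 where "M2 = ({p + 2} - P) \<times> (Y \<inter> Q)"
  define C where "C = core_rel p \<inter> ({..<n} - P) \<times> Q"
  have fin: "finite M1" "finite M2" "finite C"
    by (auto simp: M1_def M2_def C_def core_rel_def intro: finite_subset[of _ "{..<p + 3} \<times> {..<p + 3}"])
  have "(S - P) \<times> SQ - Id = C \<union> (M1 \<union> M2)"
    using n_ge by (auto simp: C_def M1_def M2_def core_rel_def SQ_def)
  moreover have "C \<inter> (M1 \<union> M2) = {}" "M1 \<inter> M2 = {}"
    by (auto simp: C_def M1_def M2_def core_rel_def)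
  ultimately have "card ((S - P) \<times> SQ - Id) = card C + (card M1 + card M2)"
    using fin by (simp add: card_Un_disjoint)
  moreover have "card ((S - P) \<times> SQ - Id) = card (S - P) * card SQ - card SQ"
  proof -
    have "(S - P) \<inter> SQ = SQ" using PQ by (auto simp: SQ_def)
    then show ?thesis using finPQ by (simp add: card_square_Diff_Id)
  qed
  moreover have "card SQ \<le> card (S - P) * card SQ"
  proof (cases "SQ = {}")
    case False
    then have "S - P \<noteq> {}" using PQ by (auto simp: SQ_def)
    then have "1 \<le> card (S - P)" by (simp add: Suc_le_eq card_gt_0_iff)
    then show ?thesis using mult_le_mono1[of 1 "card (S - P)" "card SQ"] by simp
  qed simp
  moreover have cSP: "int (card (S - P)) = int p + 3 - sP"
  proof -
    have "S - P = S - SP" by (auto simp: SP_def)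
    moreover have "SP \<subseteq> S" by (auto simp: SP_def)
    ultimately have "card (S - P) = card S - card SP" using finPQ by (simp add: card_Diff_subset)
    moreover have "card SP \<le> card S" using \<open>SP \<subseteq> S\<close> by (intro card_mono) auto
    ultimately show ?thesis by (simp add: sP_def of_nat_diff)
  qed
  moreover have cM: "int (card M1 + card M2) = \<mu>"
  proof -
    have "card ({p + 2} \<inter> Q) = of_bool (p + 2 \<in> Q)" "card ({p + 2} - P) = of_bool (p + 2 \<notin> P)"
      by (auto simp: insert_Diff_if)
    then show ?thesis by (simp add: M1_def M2_def \<mu>_def card_cartesian_product)
  qed
  ultimately have "card (S - P) * card SQ = card C + (card M1 + card M2) + card SQ"
    by linarith
  then have "int (card (S - P)) * sQ = int (card C) + int (card M1 + card M2) + sQ"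
    by (simp add: sQ_def flip: of_nat_add of_nat_mult)
  then have "int (card C) = (int p + 3 - sP) * sQ - sQ - \<mu>"
    using cSP cM by simp
  then show ?thesis by (simp add: C_def algebra_simps)
qed

lemma core_cut:
  "sum d P + int (card (core_rel p \<inter> ({..<n} - P) \<times> Q)) \<le> sum d Q + int (card P) * (int n - 1 - int (card Q))"
  using slack_bound card_core_rel unfolding slack_def by linarith

end

end

section \<open>Graphs\<close>

text \<open>Adjacent pairs from \<open>P\<close> end either outside \<open>Q\<close>, where the
  number of all pairs bounds them, or in \<open>Q\<close>, where the degrees of \<open>Q\<close> do.
  This is the source of \<open>cut_nonneg\<close>.\<close>

lemma realization_cut:
  fixes G :: "('a \<times> 'a) set" and d :: "'a \<Rightarrow> nat"
  assumes V: "finite V" and G: "G \<subseteq> V \<times> V" "irrefl G" "sym G" "\<And>a. a \<in> V \<Longrightarrow> card (G `` {a}) = d a"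
    and PQ: "P \<subseteq> V" "Q \<subseteq> V" "P \<inter> Q = {}"
  shows "(\<Sum>a\<in>P. d a) \<le> card P * (card V - 1 - card Q) + (\<Sum>a\<in>Q. d a)"
proof -
  have finG: "finite G" using V G(1) finite_subset by blast
  have rows: "(\<Sum>a\<in>X. d a) = card (G \<inter> X \<times> V)" if "X \<subseteq> V" for X
  proof -
    have "card (G `` {a} \<inter> V) = d a" if "a \<in> X" for a
    proof -
      have "G `` {a} \<inter> V = G `` {a}" using G(1) by auto
      then show ?thesis using G(4) \<open>X \<subseteq> V\<close> that by auto
    qed
    then show ?thesis using card_eq_sum_rows[OF V G(1) that, of V] by simp
  qed
  have "card (G \<inter> P \<times> V) \<le> card (G \<inter> P \<times> (V - Q)) + card (G \<inter> P \<times> Q)"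
    by (rule order_trans[OF card_mono card_Un_le]) (use finG in auto)
  also have "card (G \<inter> P \<times> (V - Q)) \<le> card (P \<times> (V - Q) - Id)"
    using G(2) V PQ finite_subset[of P V] by (intro card_mono) (auto simp: irrefl_def)
  also have "\<dots> = card P * (card V - 1 - card Q)"
    by (rule card_product_Diff_Id[OF V PQ])
  also have "card (G \<inter> P \<times> Q) \<le> card (G \<inter> Q \<times> V)"
  proof -
    have "G \<inter> P \<times> Q = (G \<inter> Q \<times> P)\<inverse>" using G(3) by (auto dest: symD)
    then have "card (G \<inter> P \<times> Q) = card (G \<inter> Q \<times> P)" by simp
    also have "\<dots> \<le> card (G \<inter> Q \<times> V)" using finG PQ by (intro card_mono) auto
    finally show ?thesis .
  qed
  finally show ?thesis using rows PQ by simp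
qed

lemma even_degree_sum:
  fixes G :: "('a \<times> 'a) set"
  assumes "finite V" "G \<subseteq> V \<times> V" "irrefl G" "sym G"
  shows "even (\<Sum>a\<in>V. card (G `` {a}))"
  using assms
proof (induction "card G" arbitrary: G rule: less_induct)
  case less
  show ?case
  proof (cases "G = {}")
    case False
    then obtain u v where uv: "(u, v) \<in> G" by auto
    have fin: "finite G" using less.prems finite_subset by blast
    define M where "M = G - {(u, v), (v, u)}"
    have ne: "u \<noteq> v" "u \<in> V" "v \<in> V" using uv less.prems by (auto simp: irrefl_def)
    have "card M < card G" using uv fin by (auto simp: M_def intro!: psubset_card_mono)
    then have "even (\<Sum>a\<in>V. card (M `` {a}))"
      using less.prems sym_remove_edge by (intro less.hyps) (auto simp: M_def irrefl_def)
    moreover have "(\<Sum>a\<in>V. card (G `` {a})) = (\<Sum>a\<in>V. card (M `` {a})) + (\<Sum>a\<in>V. of_bool (a = u \<or> a = v))"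
      unfolding sum.distrib[symmetric] M_def using card_Image_remove_edge[OF fin less.prems(4,3) uv] by simp
    moreover have "(\<Sum>a\<in>V. of_bool (a = u \<or> a = v)) = card {u, v}"
    proof -
      have "V \<inter> {a. a = u \<or> a = v} = {u, v}" using ne by auto
      then show ?thesis using less.prems(1) by (subst sum_of_bool_eq) auto
    qed
    ultimately show ?thesis using ne by simp
  qed simp
qed

section \<open>Graphs as symmetric relations\<close>

definition adj :: "'a graph \<Rightarrow> ('a \<times> 'a) set" where
  "adj G = {(u, v). {u, v} \<in> edges G}"

lemma adj_simple:
  assumes "simple_graph G"
  shows "adj G \<subseteq> verts G \<times> verts G" "irrefl (adj G)" "sym (adj G)"
  using assms by (auto simp: adj_def simple_graph_def irrefl_def sym_def insert_commute)

lemma degree_adj: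
  assumes "simple_graph G"
  shows "degree G v = card (adj G `` {v})"
proof -
  have "{e \<in> edges G. v \<in> e} = (\<lambda>u. {v, u}) ` (adj G `` {v})"
  proof (intro equalityI subsetI)
    fix e assume e: "e \<in> {e \<in> edges G. v \<in> e}"
    then have "card e = 2" using assms by (auto simp: simple_graph_def)
    then obtain x y where xy: "e = {x, y}" by (auto simp: card_2_iff)
    then have "e = {v, x} \<or> e = {v, y}" using e by auto
    then show "e \<in> (\<lambda>u. {v, u}) ` (adj G `` {v})" using e by (auto simp: adj_def)
  qed (auto simp: adj_def)
  moreover have "inj_on (\<lambda>u. {v, u}) (adj G `` {v})"
    by (auto simp: inj_on_def doubleton_eq_iff)
  ultimately show ?thesis by (simp add: degree_def card_image)
qed

lemma realization_of_relation:
  assumes "R \<subseteq> {..<length \<pi>} \<times> {..<length \<pi>}" "irrefl R" "sym R"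
    and "\<And>v. v < length \<pi> \<Longrightarrow> card (R `` {v}) = \<pi> ! v"
  defines "G \<equiv> Graph {..<length \<pi>} {{u, v} | u v. (u, v) \<in> R}"
  shows "realization \<pi> G" "adj G = R"
proof -
  have "simple_graph G"
    using assms(1,2) by (fastforce simp: simple_graph_def G_def card_2_iff irrefl_def)
  moreover show "adj G = R"
    using assms(3) by (auto simp: adj_def G_def doubleton_eq_iff dest: symD)
  ultimately show "realization \<pi> G"
    using assms(4) by (simp add: realization_def degree_adj) (simp add: G_def)
qed

lemma contains_copyI:
  assumes "simple_graph F" "inj_on f (verts F)" "f ` verts F \<subseteq> verts G"
    and "\<And>e. e \<in> edges F \<Longrightarrow> f ` e \<in> edges G"
  shows "contains_copy G F"
  unfolding contains_copy_def
proof (intro exI conjI)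
  let ?F = "Graph (f ` verts F) ((`) f ` edges F)"
  have "card (f ` e) = 2" if "e \<in> edges F" for e
  proof -
    have "e \<subseteq> verts F" "card e = 2" using that assms(1) by (auto simp: simple_graph_def)
    then show ?thesis using assms(2) by (simp add: card_image inj_on_subset)
  qed
  moreover have "f ` e \<subseteq> f ` verts F" if "e \<in> edges F" for e
    using that assms(1) by (auto simp: simple_graph_def)
  ultimately show "subgraph ?F G"
    using assms by (auto simp: subgraph_def simple_graph_def)
  show "isomorphic F ?F"
    unfolding isomorphic_def using assms(2) by (intro exI[of _ f]) (auto simp: bij_betw_def)
qed

lemma simple_delete_complete: "simple_graph (delete_edges (complete_graph m) H)"
  by (auto simp: simple_graph_def delete_edges_def complete_graph_def)

lemma potentially_graphicI:
  assumes "R \<subseteq> {..<length \<pi>} \<times> {..<length \<pi>}" "irrefl R" "sym R"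
    and "\<And>v. v < length \<pi> \<Longrightarrow> card (R `` {v}) = \<pi> ! v"
    and f: "inj_on f {..<m}" "f ` {..<m} \<subseteq> {..<length \<pi>}"
    and "\<And>u v. u < m \<Longrightarrow> v < m \<Longrightarrow> u \<noteq> v \<Longrightarrow> (f u, f v) \<notin> R \<Longrightarrow> {u, v} \<in> edges H"
  shows "potentially_graphic (delete_edges (complete_graph m) H) \<pi>"
proof -
  let ?G = "Graph {..<length \<pi>} {{u, v} | u v. (u, v) \<in> R}"
  have "contains_copy ?G (delete_edges (complete_graph m) H)"
  proof (rule contains_copyI[OF simple_delete_complete])
    fix e assume e: "e \<in> edges (delete_edges (complete_graph m) H)"
    then obtain u v where "e = {u, v}" "u < m" "v < m" "u \<noteq> v" "{u, v} \<notin> edges H"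
      by (auto simp: delete_edges_def complete_graph_def card_2_iff)
    moreover from this have "(f u, f v) \<in> R" using assms(7) by blast
    ultimately show "f ` e \<in> edges ?G" by auto
  qed (use f in \<open>auto simp: delete_edges_def complete_graph_def\<close>)
  then show ?thesis
    using realization_of_relation[OF assms(1-4)] by (auto simp: potentially_graphic_def)
qed

lemma extend_to_bijection:
  assumes "finite A" "X \<subseteq> A" "inj_on g X" "g ` X \<subseteq> A"
  shows "\<exists>f. bij_betw f A A \<and> (\<forall>x\<in>X. f x = g x)"
proof -
  have fin: "finite X" using assms(1,2) finite_subset by blast
  have "card (A - X) = card (A - g ` X)"
    using assms fin by (simp add: card_Diff_subset card_image)
  then obtain h where h: "bij_betw h (A - X) (A - g ` X)"
    using assms(1) finite_same_card_bij by (metis finite_Diff)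
  define f where "f = (\<lambda>x. if x \<in> X then g x else h x)"
  have "bij_betw f X (g ` X)" using assms(3) by (auto simp: bij_betw_def f_def inj_on_def)
  moreover have "bij_betw f (A - X) (A - g ` X)"
    using h by (rule bij_betw_cong[THEN iffD1, rotated]) (auto simp: f_def)
  ultimately have "bij_betw f (X \<union> (A - X)) (g ` X \<union> (A - g ` X))"
    by (intro bij_betw_combine) auto
  moreover have "X \<union> (A - X) = A" "g ` X \<union> (A - g ` X) = A" using assms by auto
  ultimately show ?thesis by (intro exI[of _ f]) (auto simp: f_def)
qed

lemma isomorphic_copy:
  assumes "simple_graph H" "isomorphic H U"
  obtains g where "inj_on g (verts U)" "g ` verts U = verts H"
    "\<And>a b. a \<in> verts U \<Longrightarrow> b \<in> verts U \<Longrightarrow> {g a, g b} \<in> edges H \<longleftrightarrow> {a, b} \<in> edges U"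
proof -
  obtain f where f: "bij_betw f (verts H) (verts U)" "(`) f ` edges H = edges U"
    using assms(2) by (auto simp: isomorphic_def)
  define g where "g = inv_into (verts H) f"
  have g: "bij_betw g (verts U) (verts H)" using f(1) by (simp add: g_def bij_betw_inv_into)
  have fg: "f (g a) = a" if "a \<in> verts U" for a
    using f(1) that by (simp add: g_def bij_betw_inv_into_right)
  have "{g a, g b} \<in> edges H \<longleftrightarrow> {a, b} \<in> edges U" if ab: "a \<in> verts U" "b \<in> verts U" for a b
  proof
    assume "{g a, g b} \<in> edges H"
    then have "f ` {g a, g b} \<in> edges U" using f(2) by blast
    then show "{a, b} \<in> edges U" using fg ab by simp
  next
    assume "{a, b} \<in> edges U"
    then obtain e where e: "e \<in> edges H" "f ` e = {a, b}" using f(2) by (metis imageE)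
    have "e \<subseteq> verts H" using e(1) assms(1) by (auto simp: simple_graph_def)
    moreover have "{g a, g b} \<subseteq> verts H" using g ab by (auto simp: bij_betw_def)
    moreover have "f ` e = f ` {g a, g b}" using e(2) fg ab by simp
    ultimately have "e = {g a, g b}"
      using f(1) by (metis bij_betw_imp_inj_on inj_on_image_eq_iff)
    then show "{g a, g b} \<in> edges H" using e(1) by simp
  qed
  then show ?thesis using that[of g] g by (auto simp: bij_betw_def)
qed

text \<open>The dichotomy is the size of the term with index \<open>p - 1\<close>: if it is at least
  \<open>p + 2\<close>, the factor theorem applies with \<open>core_cut\<close>, otherwise the
  sequence is the one of \<open>core_low_imp_extremal\<close>.\<close>

lemma core_realizable:
  fixes \<pi> :: "nat list"
  assumes p: "2 \<le> p" "4 * p + 18 \<le> length \<pi>" and gr: "graphic \<pi>"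
    and sum: "int p * (2 * int (length \<pi>) - int p - 1) + 2 \<le> int (sum_list \<pi>)"
  obtains R where "R \<subseteq> {..<length \<pi>} \<times> {..<length \<pi>}" "irrefl R" "sym R"
      "\<And>v. v < length \<pi> \<Longrightarrow> card (R `` {v}) = \<pi> ! v" "core_rel p \<subseteq> R"
    | "\<forall>i<p - 1. \<pi> ! i = length \<pi> - 1" "\<forall>i\<in>{p - 1..<length \<pi>}. \<pi> ! i = p + 1"
proof -
  define n where "n = length \<pi>"
  define d where "d = (\<lambda>i. int (\<pi> ! i))"
  obtain G where G: "realization \<pi> G" and sorted: "sorted_wrt (\<ge>) \<pi>"
    using gr by (auto simp: graphic_def)
  have sg: "simple_graph G" and vG: "verts G = {..<n}" using G by (auto simp: realization_def n_def)
  have deg: "card (adj G `` {a}) = \<pi> ! a" if "a \<in> {..<n}" for a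
    using G that degree_adj[OF sg] by (simp add: realization_def n_def)
  note aG = adj_simple[OF sg, unfolded vG]
  have even: "even (\<Sum>i<n. \<pi> ! i)"
    using even_degree_sum[OF _ aG] deg by simp
  have sl: "(\<Sum>i<n. d i) = int (sum_list \<pi>)"
    by (simp add: d_def n_def sum_list_sum_nth atLeast0LessThan)
  interpret dense_degrees n p d
  proof
    show "sum d P \<le> int (card P) * (int n - 1 - int (card Q)) + sum d Q"
      if "P \<subseteq> {..<n}" "Q \<subseteq> {..<n}" "P \<inter> Q = {}" for P Q
    proof (cases "P = {}")
      case False
      \<comment> \<open>A nonempty \<open>P\<close> keeps \<open>card Q\<close> below
        \<open>n\<close>, so that the truncated subtraction is exact.\<close>
      then have "Q \<noteq> {..<n}" using that by auto
      then have "card Q < n" using that(2) psubset_card_mono[of "{..<n}" Q] by auto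
      then have "int (n - 1 - card Q) = int n - 1 - int (card Q)" by simp
      moreover have "int (\<Sum>a\<in>P. \<pi> ! a) \<le> int (card P * (n - 1 - card Q) + (\<Sum>a\<in>Q. \<pi> ! a))"
        unfolding of_nat_le_iff using realization_cut[OF _ aG deg that] by simp
      ultimately show ?thesis by (simp add: d_def)
    qed (simp add: d_def sum_nonneg)
    show "d j \<le> d i" if "i \<le> j" "j < n" for i j
      using sorted that by (cases "i = j") (auto simp: d_def n_def sorted_wrt_iff_nth_less)
    show "even (\<Sum>i<n. d i)" using even by (simp add: d_def flip: of_nat_sum)
    show "int p * (2 * int n - int p - 1) + 2 \<le> (\<Sum>i<n. d i)" using sl sum by (simp add: n_def)
  qed (use p in \<open>auto simp: n_def\<close>)
  show ?thesis
  proof (cases "d (p - 1) < int p + 2")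
    case True
    have "\<pi> ! i = n - 1" if "i < p - 1" for i
      using core_low_imp_extremal(1)[OF True] that p by (auto simp: d_def n_def)
    moreover have "\<pi> ! i = p + 1" if "i \<in> {p - 1..<n}" for i
    proof -
      have "int (\<pi> ! i) = int p + 1" using core_low_imp_extremal(2)[OF True] that unfolding d_def by blast
      then show ?thesis by linarith
    qed
    ultimately show ?thesis using that(2) by (simp add: n_def)
  next
    case False
    have "\<exists>G'. core_rel p \<subseteq> G' \<and> G' \<subseteq> {..<n} \<times> {..<n} \<and> irrefl G' \<and> sym G' \<and> (\<forall>a\<in>{..<n}. card (G' `` {a}) = \<pi> ! a)"
    \<comment> \<open>The colouring singles out the middle \<open>p + 2\<close> of the missing path,
      which belongs to every missing pair.\<close>
    proof (rule realization_containing[OF _ _ _ _ _ aG deg even, where S = "{..<p + 3}" and col = "\<lambda>a. a = p + 2"])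
      show "irrefl (core_rel p)" "sym (core_rel p)" "core_rel p \<subseteq> {..<p + 3} \<times> {..<p + 3}"
        by (auto simp: core_rel_def irrefl_def sym_def)
      show "(a = p + 2) \<noteq> (b = p + 2)" if "a \<in> {..<p + 3}" "b \<in> {..<p + 3}" "a \<noteq> b" "(a, b) \<notin> core_rel p" for a b
        using that by (auto simp: core_rel_def)
      show "(\<Sum>a\<in>P. \<pi> ! a) + card (core_rel p \<inter> ({..<n} - P) \<times> Q) \<le> (\<Sum>a\<in>Q. \<pi> ! a) + card P * (card {..<n} - 1 - card Q)"
        if PQ: "P \<subseteq> {..<n}" "Q \<subseteq> {..<n}" "P \<inter> Q = {}" for P Q
      proof (cases "P = {}")
        case True
        have *: "int (card (core_rel p \<inter> ({..<n} - P) \<times> Q)) \<le> sum d Q"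
          using core_cut[OF _ PQ] False True by simp
        have "sum d Q = int (\<Sum>a\<in>Q. \<pi> ! a)" by (simp add: d_def)
        then have "card (core_rel p \<inter> ({..<n} - P) \<times> Q) \<le> (\<Sum>a\<in>Q. \<pi> ! a)"
          using * by linarith
        then show ?thesis using True by simp
      next
        case P: False
        then have "Q \<noteq> {..<n}" using PQ by auto
        then have "card Q < n" using PQ(2) psubset_card_mono[of "{..<n}" Q] by auto
        then have "int (n - 1 - card Q) = int n - 1 - int (card Q)" by simp
        then have "int ((\<Sum>a\<in>P. \<pi> ! a) + card (core_rel p \<inter> ({..<n} - P) \<times> Q)) \<le> int ((\<Sum>a\<in>Q. \<pi> ! a) + card P * (card {..<n} - 1 - card Q))"
          using core_cut[OF _ PQ] False by (simp add: d_def)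
        then show ?thesis unfolding of_nat_le_iff .
      qed
    qed (use p in \<open>auto simp: n_def\<close>)
    then show ?thesis using that(1) by (auto simp: n_def)
  qed
qed

text \<open>The witness is the join of \<open>K\<^sub>q\<close> with a 4-cycle on \<open>q, \<dots>, q + 3\<close> and a cycle on the other vertices.\<close>

lemma join_cycles_realization:
  assumes n: "q + 7 \<le> n"
  obtains R where "R \<subseteq> {..<n} \<times> {..<n}" "irrefl R" "sym R"
    "\<And>v. v < q \<Longrightarrow> card (R `` {v}) = n - 1" "\<And>v. q \<le> v \<Longrightarrow> v < n \<Longrightarrow> card (R `` {v}) = q + 2"
    "\<And>u v. u < q + 4 \<Longrightarrow> v < q + 4 \<Longrightarrow> u \<noteq> v \<Longrightarrow> (u, v) \<notin> R \<Longrightarrow> {u, v} = {q, q + 2} \<or> {u, v} = {q + 1, q + 3}"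
proof
  \<comment> \<open>Successor and predecessor along the two cycles. The second one has at least
    three vertices because \<open>q + 7 \<le> n\<close>.\<close>
  define s where "s = (\<lambda>u. if u = q + 3 then q else if u = n - 1 then q + 4 else u + 1)"
  define s' where "s' = (\<lambda>u. if u = q then q + 3 else if u = q + 4 then n - 1 else u - 1)"
  define R where "R = {(u, v). u < n \<and> v < n \<and> u \<noteq> v \<and> (u < q \<or> v < q \<or> v = s u \<or> v = s' u)}"
  have s: "q \<le> s u" "s u < n" "s u \<noteq> u" "s' (s u) = u" if "q \<le> u" "u < n" for u
    using that n by (auto simp: s_def s'_def)
  have s': "q \<le> s' u" "s' u < n" "s' u \<noteq> u" "s (s' u) = u" if "q \<le> u" "u < n" for u
    using that n by (auto simp: s_def s'_def)
  have ss': "s u \<noteq> s' u" if "q \<le> u" "u < n" for u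
    using that n by (auto simp: s_def s'_def)
  show "R \<subseteq> {..<n} \<times> {..<n}" "irrefl R" by (auto simp: R_def irrefl_def)
  show "sym R"
  proof (rule symI)
    fix u v assume "(u, v) \<in> R"
    then show "(v, u) \<in> R" using s(4)[of u] s'(4)[of u] by (cases "u < q") (auto simp: R_def)
  qed
  show "card (R `` {v}) = n - 1" if "v < q" for v
  proof -
    have "R `` {v} = {..<n} - {v}" using that n by (auto simp: R_def)
    then show ?thesis using that n by simp
  qed
  show "card (R `` {v}) = q + 2" if "q \<le> v" "v < n" for v
  proof -
    have "R `` {v} = {..<q} \<union> {s v, s' v}"
      using that n s[OF that] s'[OF that] by (auto simp: R_def)
    moreover have "card ({..<q} \<union> {s v, s' v}) = q + 2"
      using s(1)[OF that] s'(1)[OF that] ss'[OF that] by (subst card_Un_disjoint) auto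
    ultimately show ?thesis by simp
  qed
  show "{u, v} = {q, q + 2} \<or> {u, v} = {q + 1, q + 3}"
    if "u < q + 4" "v < q + 4" "u \<noteq> v" "(u, v) \<notin> R" for u v
  proof -
    have "q \<le> u" "q \<le> v" using that n by (auto simp: R_def)
    then have "u = q \<or> u = q + 1 \<or> u = q + 2 \<or> u = q + 3" "v = q \<or> v = q + 1 \<or> v = q + 2 \<or> v = q + 3"
      using that by linarith+
    moreover have "s q = q + 1" "s (q + 1) = q + 2" "s (q + 2) = q + 3" "s (q + 3) = q"
      "s' q = q + 3" "s' (q + 1) = q" "s' (q + 2) = q + 1" "s' (q + 3) = q + 2"
      using n by (auto simp: s_def s'_def)
    ultimately show ?thesis using that n unfolding R_def by auto
  qed
qed

section \<open>The lower bound: an extremal sequence\<close>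

abbreviation (input) path_edge_union :: "nat \<Rightarrow> nat \<Rightarrow> (nat \<times> nat + nat \<times> nat) graph" where
  "path_edge_union k t \<equiv> disjoint_union (copies k (path_graph 2)) (copies t (complete_graph 2))"

text \<open>\<open>case_sum snd snd\<close> extracts the position of a vertex within its component.
  Edges join consecutive positions, so the parity is a proper 2-colouring.\<close>

lemma edges_path_edge_union_bipartite:
  assumes "e \<in> edges (path_edge_union k t)"
  shows "\<exists>a b. e = {a, b} \<and> even (case_sum snd snd a) \<noteq> even (case_sum snd snd b)"
proof -
  from assms have "(\<exists>e1\<in>edges (copies k (path_graph 2)). e = Inl ` e1) \<or> (\<exists>e1\<in>edges (copies t (complete_graph 2)). e = Inr ` e1)"
    by (auto simp: disjoint_union_def)
  then show ?thesis
  proof (elim disjE bexE)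
    fix e1 assume "e1 \<in> edges (copies k (path_graph 2))" and e: "e = Inl ` e1"
    then obtain i j where "e1 = Pair i ` {j, Suc j}" by (auto simp: copies_def path_graph_def)
    then show ?thesis using e by (intro exI[of _ "Inl (i, j)"] exI[of _ "Inl (i, Suc j)"]) simp
  next
    fix e1 assume "e1 \<in> edges (copies t (complete_graph 2))" and e: "e = Inr ` e1"
    then obtain i e' where e': "e1 = Pair i ` e'" "e' \<subseteq> {..<2}" "card e' = 2"
      by (auto simp: copies_def complete_graph_def)
    then have "e' = {..<2}" by (intro card_subset_eq) auto
    then have "e' = {0, 1}" by auto
    then show ?thesis using e e'(1) by (intro exI[of _ "Inr (i, 0)"] exI[of _ "Inr (i, 1)"]) simp
  qed
qed

lemma path_edge_union_triangle_free:
  assumes "{a, b} \<in> edges (path_edge_union k t)" "{b, c} \<in> edges (path_edge_union k t)"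
  shows "{a, c} \<notin> edges (path_edge_union k t)"
proof
  assume "{a, c} \<in> edges (path_edge_union k t)"
  moreover have "even (case_sum snd snd x) \<noteq> even (case_sum snd snd y)"
    if "{x, y} \<in> edges (path_edge_union k t)" for x y
    using edges_path_edge_union_bipartite[OF that] by (auto simp: doubleton_eq_iff)
  ultimately show False using assms by blast
qed

lemma threshold_not_potential:
  assumes p: "p + 3 \<le> n" and H: "subgraph H (complete_graph (p + 3))"
    and iso: "isomorphic H (path_edge_union k t)"
  defines "\<pi> \<equiv> replicate p (n - 1) @ replicate (n - p) p"
  shows "graphic \<pi>" "length \<pi> = n" "int (sum_list \<pi>) = int p * (2 * int n - int p - 1)"
    "\<not> potentially_graphic (delete_edges (complete_graph (p + 3)) H) \<pi>"
proof -
  show len: "length \<pi> = n" using p by (simp add: \<pi>_def)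
  have nth: "\<pi> ! i = (if i < p then n - 1 else p)" if "i < n" for i
    using that by (simp add: \<pi>_def nth_append)
  have "int (sum_list \<pi>) = int p * int (n - 1) + int (n - p) * int p"
    by (simp add: \<pi>_def sum_list_replicate)
  also have "\<dots> = int p * (int n - 1) + (int n - int p) * int p" using p by (simp add: of_nat_diff)
  finally show "int (sum_list \<pi>) = int p * (2 * int n - int p - 1)" by (simp add: algebra_simps)
  define R where "R = {(u, v). u < n \<and> v < n \<and> u \<noteq> v \<and> (u < p \<or> v < p)}"
  have "card (R `` {v}) = \<pi> ! v" if "v < length \<pi>" for v
  proof (cases "v < p")
    case True
    then have "R `` {v} = {..<n} - {v}" using p by (auto simp: R_def)
    then show ?thesis using that len nth True by simp
  next
    case False
    then have "R `` {v} = {..<p}" using p that len by (auto simp: R_def)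
    then show ?thesis using that len nth False by simp
  qed
  then have "realization \<pi> (Graph {..<length \<pi>} {{u, v} | u v. (u, v) \<in> R})"
    using len by (intro realization_of_relation(1)) (auto simp: R_def irrefl_def sym_def)
  moreover have "sorted_wrt (\<ge>) \<pi>"
    using p nth len by (auto simp: sorted_wrt_iff_nth_less)
  ultimately show "graphic \<pi>" by (auto simp: graphic_def)
  show "\<not> potentially_graphic (delete_edges (complete_graph (p + 3)) H) \<pi>"
  proof
    assume "potentially_graphic (delete_edges (complete_graph (p + 3)) H) \<pi>"
    then obtain G F' where G: "realization \<pi> G" and F': "subgraph F' G"
      "isomorphic (delete_edges (complete_graph (p + 3)) H) F'"
      by (auto simp: potentially_graphic_def contains_copy_def)
    obtain f where f: "bij_betw f {..<p + 3} (verts F')" "(`) f ` edges (delete_edges (complete_graph (p + 3)) H) = edges F'"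
      using F'(2) by (auto simp: isomorphic_def delete_edges_def complete_graph_def)
    have sg: "simple_graph G" and vG: "verts G = {..<n}" using G len by (auto simp: realization_def)
    have deg: "card (adj G `` {v}) = (if v < p then n - 1 else p)" if "v < n" for v
      using G that nth degree_adj[OF sg] len by (simp add: realization_def)
    note aG = adj_simple[OF sg, unfolded vG]
    have top: "adj G `` {u} = {..<n} - {u}" if "u < p" for u
    proof (rule card_subset_eq)
      show "adj G `` {u} \<subseteq> {..<n} - {u}" using aG by (auto simp: irrefl_def)
      show "card (adj G `` {u}) = card ({..<n} - {u})" using deg[of u] that p by simp
    qed simp
    have low: "adj G `` {u} = {..<p}" if "p \<le> u" "u < n" for u
    proof (rule card_subset_eq[symmetric])
      show "{..<p} \<subseteq> adj G `` {u}"
      proof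
        fix v assume "v \<in> {..<p}"
        then have "u \<in> adj G `` {v}" using top[of v] that by auto
        then show "v \<in> adj G `` {u}" using aG(3) by (auto dest: symD)
      qed
      show "finite (adj G `` {u})" using aG(1) finite_subset[of _ "{..<n} \<times> {..<n}"] by (auto intro: finite_Image)
      show "card {..<p} = card (adj G `` {u})" using deg[of u] that by simp
    qed
    define L where "L = {u. u < p + 3 \<and> p \<le> f u}"
    have finj: "inj_on f {..<p + 3}" using f(1) by (simp add: bij_betw_def)
    have fn: "f u < n" if "u < p + 3" for u
      using f(1) F'(1) vG that by (auto simp: bij_betw_def subgraph_def)
    have inH: "{u, v} \<in> edges H" if "u \<in> L" "v \<in> L" "u \<noteq> v" for u v
    proof (rule ccontr)
      assume "{u, v} \<notin> edges H"
      then have "{u, v} \<in> edges (delete_edges (complete_graph (p + 3)) H)"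
        using that by (auto simp: delete_edges_def complete_graph_def L_def)
      then have "f ` {u, v} \<in> edges F'" using f(2) by blast
      then have "f v \<in> adj G `` {f u}" using F'(1) by (auto simp: subgraph_def adj_def)
      moreover have "f v \<notin> {..<p}" using that by (simp add: L_def)
      moreover have "adj G `` {f u} = {..<p}" using low[of "f u"] that fn by (simp add: L_def)
      ultimately show False by blast
    qed
    \<comment> \<open>At most \<open>p\<close> vertices are mapped to the universal ones, so at
      least three land in the independent part.\<close>
    have "card ({..<p + 3} - L) \<le> card {..<p}"
      using finj by (intro card_inj_on_le[of f]) (auto simp: L_def intro: inj_on_subset)
    moreover have "card ({..<p + 3} - L) = p + 3 - card L"
      by (subst card_Diff_subset) (auto simp: L_def)
    ultimately have "3 \<le> card L" by simp
    then obtain L' where "L' \<subseteq> L" "card L' = 3" by (meson obtain_subset_with_card_n)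
    then obtain x y z where xyz: "{x, y, z} \<subseteq> L" "x \<noteq> y" "y \<noteq> z" "x \<noteq> z" by (auto simp: card_3_iff)
    then have tri: "{x, y} \<in> edges H" "{y, z} \<in> edges H" "{x, z} \<in> edges H" using inH by auto
    have sH: "simple_graph H" using H by (simp add: subgraph_def)
    obtain g where g: "g ` verts (path_edge_union k t) = verts H"
      "\<And>a b. a \<in> verts (path_edge_union k t) \<Longrightarrow> b \<in> verts (path_edge_union k t) \<Longrightarrow>
        {g a, g b} \<in> edges H \<longleftrightarrow> {a, b} \<in> edges (path_edge_union k t)"
      using isomorphic_copy[OF sH iso] by metis
    have "x \<in> verts H" "y \<in> verts H" "z \<in> verts H" using tri sH by (auto simp: simple_graph_def)
    then obtain a b c where abc: "x = g a" "y = g b" "z = g c" and V: "a \<in> verts (path_edge_union k t)"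
      "b \<in> verts (path_edge_union k t)" "c \<in> verts (path_edge_union k t)"
      unfolding g(1)[symmetric] by (elim imageE)
    have "{a, b} \<in> edges (path_edge_union k t)" "{b, c} \<in> edges (path_edge_union k t)"
      "{a, c} \<in> edges (path_edge_union k t)"
      using tri unfolding abc g(2)[OF V(1,2)] g(2)[OF V(2,3)] g(2)[OF V(1,3)] by blast+
    then show False using path_edge_union_triangle_free by blast
  qed
qed

section \<open>The upper bound: placing the deleted edges\<close>

lemma path_edge_union_edges:
  assumes "2 \<le> k + t" "1 \<le> k" and H: "simple_graph H" and iso: "isomorphic H (path_edge_union k t)"
  obtains a b c u v where "{a, b, c, u, v} \<subseteq> verts H" "distinct [a, b, c, u, v]"
    "{a, b} \<in> edges H" "{b, c} \<in> edges H" "{u, v} \<in> edges H"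
proof -
  define U where "U = path_edge_union k t"
  obtain g where g: "inj_on g (verts U)" "g ` verts U = verts H"
    "\<And>a b. a \<in> verts U \<Longrightarrow> b \<in> verts U \<Longrightarrow> {g a, g b} \<in> edges H \<longleftrightarrow> {a, b} \<in> edges U"
    using isomorphic_copy[OF H iso] unfolding U_def by metis
  have P: "Inl (i, j) \<in> verts U" if "i < k" "j \<le> 2" for i j
    using that by (auto simp: U_def disjoint_union_def copies_def path_graph_def intro: InlI)
  have Pe: "{Inl (i, j), Inl (i, Suc j)} \<in> edges U" if "i < k" "j < 2" for i j
  proof -
    have "{j, Suc j} \<in> edges (path_graph 2)" using that by (auto simp: path_graph_def)
    then have "Pair i ` {j, Suc j} \<in> edges (copies k (path_graph 2))"
      using that unfolding copies_def graph.sel by blast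
    then have "Inl ` (Pair i ` {j, Suc j}) \<in> edges U"
      unfolding U_def disjoint_union_def graph.sel by blast
    then show ?thesis by simp
  qed
  have "\<exists>u v. u \<in> verts U \<and> v \<in> verts U \<and> distinct [Inl (0, 0), Inl (0, 1), Inl (0, 2), u, v] \<and> {u, v} \<in> edges U"
  proof (cases "k = 1")
    case True
    then have t: "0 < t" using assms by simp
    have "{0, 1} \<in> edges (complete_graph 2)" by (auto simp: complete_graph_def)
    then have "Pair 0 ` {0, 1} \<in> edges (copies t (complete_graph 2))"
      using t unfolding copies_def graph.sel by blast
    then have "Inr ` (Pair 0 ` {0, 1}) \<in> edges U"
      unfolding U_def disjoint_union_def graph.sel by blast
    moreover have "Inr (0, 0) \<in> verts U" "Inr (0, 1) \<in> verts U"
      using t by (auto simp: U_def disjoint_union_def copies_def complete_graph_def)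
    ultimately show ?thesis by (intro exI[of _ "Inr (0, 0)"] exI[of _ "Inr (0, 1)"]) simp
  next
    case False
    then show ?thesis using assms P[of 1] Pe[of 1 0]
      by (intro exI[of _ "Inl (1, 0)"] exI[of _ "Inl (1, 1)"]) simp
  qed
  then obtain u v where uv: "u \<in> verts U" "v \<in> verts U" "distinct [Inl (0, 0), Inl (0, 1), Inl (0, 2), u, v]" "{u, v} \<in> edges U"
    by blast
  have V: "Inl (0, 0) \<in> verts U" "Inl (0, 1) \<in> verts U" "Inl (0, 2) \<in> verts U" using P assms by auto
  show ?thesis
  proof (rule that[of "g (Inl (0, 0))" "g (Inl (0, 1))" "g (Inl (0, 2))" "g u" "g v"])
    show "distinct [g (Inl (0, 0)), g (Inl (0, 1)), g (Inl (0, 2)), g u, g v]"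
    proof -
      have "distinct (map g [Inl (0, 0), Inl (0, 1), Inl (0, 2), u, v])"
        unfolding distinct_map using uv V by (intro conjI inj_on_subset[OF g(1)]) auto
      then show ?thesis by simp
    qed
    show "{g (Inl (0, 0)), g (Inl (0, 1))} \<in> edges H" "{g (Inl (0, 1)), g (Inl (0, 2))} \<in> edges H"
      using g(3) V Pe[of 0 0] Pe[of 0 1] assms by (auto simp: numeral_2_eq_2)
  qed (use uv V g(2,3) in auto)
qed

text \<open>Only few edges of \<open>H\<close> matter: the nonadjacent pairs of the core are matched
  with a path \<open>a b c\<close> of \<open>H\<close>, or, for the exceptional sequence, with two
  disjoint edges \<open>a b\<close> and \<open>u v\<close>.\<close>

lemma potentially_minus_paths:
  assumes p: "2 \<le> p" "4 * p + 18 \<le> length \<pi>" and gr: "graphic \<pi>"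
    and sum: "int p * (2 * int (length \<pi>) - int p - 1) + 2 \<le> int (sum_list \<pi>)"
    and kt: "2 \<le> k + t" "1 \<le> k"
    and H: "subgraph H (complete_graph (p + 3))" "isomorphic H (path_edge_union k t)"
  shows "potentially_graphic (delete_edges (complete_graph (p + 3)) H) \<pi>"
proof -
  have sH: "simple_graph H" "verts H \<subseteq> {..<p + 3}"
    using H(1) by (auto simp: subgraph_def complete_graph_def)
  obtain a b c u v where e: "{a, b, c, u, v} \<subseteq> verts H" "distinct [a, b, c, u, v]"
    "{a, b} \<in> edges H" "{b, c} \<in> edges H" "{u, v} \<in> edges H"
    using path_edge_union_edges[OF kt sH(1) H(2)] by blast
  have lt: "{a, b, c, u, v} \<subseteq> {..<p + 3}" using e(1) sH(2) by blast
  from core_realizable[OF p gr sum] show ?thesis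
  proof cases
    case (1 R)
    define g where "g = (\<lambda>x. if x = b then p + 2 else if x = a then p else p + 1)"
    have "\<exists>f. bij_betw f {..<p + 3} {..<p + 3} \<and> (\<forall>x\<in>{a, b, c}. f x = g x)"
      using lt e(2) by (intro extend_to_bijection) (auto simp: g_def inj_on_def)
    then obtain f where f: "bij_betw f {..<p + 3} {..<p + 3}" "f a = p" "f b = p + 2" "f c = p + 1"
      using e(2) by (auto simp: g_def)
    have finj: "x = y" if "f x = f y" "x < p + 3" "y < p + 3" for x y
      using f(1) that by (auto simp: bij_betw_def inj_on_def)
    show ?thesis
    proof (rule potentially_graphicI[OF 1(1-4)])
      fix x y assume xy: "x < p + 3" "y < p + 3" "x \<noteq> y" "(f x, f y) \<notin> R"
      have "f x < p + 3" "f y < p + 3" using f(1) xy by (auto simp: bij_betw_def)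
      moreover have "f x \<noteq> f y" using finj xy by blast
      moreover have "(f x, f y) \<notin> core_rel p" using 1(5) xy by blast
      ultimately have "(f x = f b \<and> (f y = f a \<or> f y = f c)) \<or> (f y = f b \<and> (f x = f a \<or> f x = f c))"
        unfolding f by (auto simp: core_rel_def)
      then have "(x = b \<and> (y = a \<or> y = c)) \<or> (y = b \<and> (x = a \<or> x = c))"
        using finj xy lt by auto
      then show "{x, y} \<in> edges H" using e(3,4) by (auto simp: insert_commute)
    qed (use f(1) p in \<open>auto simp: bij_betw_def\<close>)
  next
    case 2
    define q where "q = p - 1"
    have q: "p = q + 1" using p by (simp add: q_def)
    obtain R where R: "R \<subseteq> {..<length \<pi>} \<times> {..<length \<pi>}" "irrefl R" "sym R"
      "\<And>v. v < q \<Longrightarrow> card (R `` {v}) = length \<pi> - 1" "\<And>v. q \<le> v \<Longrightarrow> v < length \<pi> \<Longrightarrow> card (R `` {v}) = q + 2"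
      "\<And>u v. u < q + 4 \<Longrightarrow> v < q + 4 \<Longrightarrow> u \<noteq> v \<Longrightarrow> (u, v) \<notin> R \<Longrightarrow> {u, v} = {q, q + 2} \<or> {u, v} = {q + 1, q + 3}"
      using join_cycles_realization[of q "length \<pi>"] p q by auto
    \<comment> \<open>The two edges go to the diagonals of the 4-cycle, the only nonadjacent pairs
      among the first \<open>q + 4\<close> vertices.\<close>
    define g where "g = (\<lambda>x. if x = a then q else if x = b then q + 2 else if x = u then q + 1 else q + 3)"
    have "\<exists>f. bij_betw f {..<p + 3} {..<p + 3} \<and> (\<forall>x\<in>{a, b, u, v}. f x = g x)"
      using lt e(2) q by (intro extend_to_bijection) (auto simp: g_def inj_on_def)
    then obtain f where f: "bij_betw f {..<p + 3} {..<p + 3}" "f a = q" "f b = q + 2" "f u = q + 1" "f v = q + 3"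
      using e(2) by (auto simp: g_def)
    have finj: "x = y" if "f x = f y" "x < p + 3" "y < p + 3" for x y
      using f(1) that by (auto simp: bij_betw_def inj_on_def)
    show ?thesis
    proof (rule potentially_graphicI[OF R(1-3)])
      show "card (R `` {w}) = \<pi> ! w" if "w < length \<pi>" for w
        using R(4,5)[of w] 2 that q by (cases "w < q") auto
      fix x y assume xy: "x < p + 3" "y < p + 3" "x \<noteq> y" "(f x, f y) \<notin> R"
      have "f x \<in> {..<p + 3}" "f y \<in> {..<p + 3}" using bij_betwE[OF f(1)] xy by simp_all
      then have "f x < q + 4" "f y < q + 4" using q by simp_all
      moreover have "f x \<noteq> f y" using finj xy by blast
      ultimately have "{f x, f y} = {f a, f b} \<or> {f x, f y} = {f u, f v}"
        unfolding f using R(6) xy by blast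
      then have "{x, y} = {a, b} \<or> {x, y} = {u, v}"
        using finj xy lt by (auto simp: doubleton_eq_iff)
      then show "{x, y} \<in> edges H" using e(3,5) by auto
    qed (use f(1) p in \<open>auto simp: bij_betw_def\<close>)
  qed
qed

theorem theorem1p2:
  fixes n r k t :: nat and H :: "nat graph"
  assumes "n \<ge> 4 * r + 10"
    and "r + 1 \<ge> 3 * k + 2 * t"
    and "k + t \<ge> 2"
    and "k \<ge> 1"
    and "t \<ge> 0"
    and "subgraph H (complete_graph (r + 1))"
    and "isomorphic H (disjoint_union (copies k (path_graph 2)) (copies t (complete_graph 2)))"
  shows "sigma (delete_edges (complete_graph (r + 1)) H) n
           = (int r - 1) * (2 * int n - int r) - 2 * (int n - int r)"
proof -
  \<comment> \<open>From \<open>k + t \<ge> 2\<close> and \<open>k \<ge> 1\<close> one gets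
    \<open>3 * k + 2 * t \<ge> 5\<close>, hence \<open>p \<ge> 2\<close>; and
    \<open>4 * r + 10\<close> is \<open>4 * p + 18\<close>.\<close>
  define p where "p = r - 2"
  have r: "r = p + 2" "2 \<le> p" "r + 1 = p + 3" using assms(2-4) by (auto simp: p_def)
  define l where "l = int p * (2 * int n - int p - 1) + 2"
  have l_eq: "(int r - 1) * (2 * int n - int r) - 2 * (int n - int r) = l"
    by (simp add: r(1) l_def algebra_simps)
  have l_even: "even l" by (simp add: l_def)
  have H: "subgraph H (complete_graph (p + 3))" using assms(6) unfolding r(3) .
  show ?thesis
    unfolding sigma_def l_eq r(3)
  proof (rule Least_equality)
    show "even l \<and> (\<forall>\<pi>. graphic \<pi> \<and> length \<pi> = n \<and> l \<le> int (sum_list \<pi>) \<longrightarrow>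
      potentially_graphic (delete_edges (complete_graph (p + 3)) H) \<pi>)"
      using l_even potentially_minus_paths[OF r(2) _ _ _ assms(3,4) H assms(7)] assms(1) r(1)
      by (auto simp: l_def)
    fix y assume y: "even y \<and> (\<forall>\<pi>. graphic \<pi> \<and> length \<pi> = n \<and> y \<le> int (sum_list \<pi>) \<longrightarrow>
      potentially_graphic (delete_edges (complete_graph (p + 3)) H) \<pi>)"
    show "l \<le> y"
    proof (rule ccontr)
      assume "\<not> l \<le> y"
      \<comment> \<open>By parity, \<open>y\<close> is at most the sum of the extremal sequence,
        which is exactly \<open>l - 2\<close>.\<close>
      then have "y \<le> l - 2" using conjunct1[OF y] l_even by presburger
      then show False
        using y threshold_not_potential[OF _ H assms(7), of n] assms(1) r(1) by (auto simp: l_def)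
    qed
  qed
qed

end
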